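(* Let $0<\alpha<\pi/4$ and let $G_\alpha$ be the closed set of $s=\sigma+it$ with $|t|\tan 2\alpha\le 1-\sigma$. Then, as $|s|\to\infty$ with $s\in G_\alpha$, $$\mathcal{R}(s)=\frac{e^{-\pi i/8}}{\sqrt2}\,\chi(s)\,\eta^{s-1}e^{\pi i(\eta-\eta^2)}\bigl(1+O(|\eta|^{-1})\bigr).$$
   Context: $\mathcal{R}(s)=\int_{0\swarrow 1}\frac{x^{-s}e^{\pi i x^2}}{e^{\pi i x}-e^{-\pi i x}}\,dx$ (Riemann's auxiliary function), where $0\swarrow1$ is a straight line of direction $e^{-3\pi i/4}$ crossing the real axis in $(0,1)$ and $x^{-s}$ is the principal branch. $\chi(s)=\pi^{s-1/2}\Gamma(\frac{1-s}{2})/\Gamma(\frac s2)$. $\eta:=\sqrt{(s-1)/(2\pi i)}$ with $-\pi/4<\arg\eta<3\pi/4$; $\eta^{s-1}$ is the principal power. *)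

theory Defs
  imports "HOL-Analysis.Analysis"
begin

text \<open>Direction of the integration line 0 \<swarrow> 1.\<close>
definition swdir :: complex where
  "swdir = cis (-(3 * pi / 4))"

definition R_integrand :: "complex \<Rightarrow> complex \<Rightarrow> complex" where
  "R_integrand s x =
     x powr (-s) * exp (pi * \<i> * x\<^sup>2) / (exp (pi * \<i> * x) - exp (- (pi * \<i> * x)))"

text \<open>Riemann's auxiliary function: the integral along the straight line
  through 1/2 with direction e^{-3 pi i/4}, parametrised as x = 1/2 + r e^{-3 pi i/4},
  r running over the real line (dx = e^{-3 pi i/4} dr).\<close>
definition riemann_R :: "complex \<Rightarrow> complex" where
  "riemann_R s = integral UNIV (\<lambda>r::real. R_integrand s (1/2 + of_real r * swdir) * swdir)"

definition chi :: "complex \<Rightarrow> complex" where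
  "chi s = of_real pi powr (s - 1/2) * Gamma ((1 - s) / 2) / Gamma (s / 2)"

definition eta :: "complex \<Rightarrow> complex" where
  "eta s = (THE w. w\<^sup>2 = (s - 1) / (2 * pi * \<i>) \<and> - (pi / 4) < Arg w \<and> Arg w < 3 * pi / 4)"

definition G_region :: "real \<Rightarrow> complex set" where
  "G_region \<alpha> = {s. \<bar>Im s\<bar> * tan (2 * \<alpha>) \<le> 1 - Re s}"

definition R_main :: "complex \<Rightarrow> complex" where
  "R_main s = exp (- (pi * \<i> / 8)) / sqrt 2 * chi s * eta s powr (s - 1)
               * exp (pi * \<i> * (eta s - (eta s)\<^sup>2))"

end

theory Submission
  imports Defs "HOL-Complex_Analysis.Complex_Analysis" "HOL-Probability.Probability"
    "HOL-Real_Asymp.Real_Asymp"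
begin

text \<open>
  Put \<open>z = 1 - s\<close>, so that \<open>z = -2\<pi>i \<eta>\<^sup>2\<close> and \<open>\<eta>\<close> lies in the open first quadrant. Since \<open>Re s < 0\<close>
  the line of integration can be turned into the two rays \<open>\<plusminus>\<eta>\<tau>\<close>, \<open>\<tau> > 0\<close>; on the second ray the
  integrand is a constant multiple of that on the first. With \<open>\<phi>(\<tau>) = ln \<tau> - (\<tau>\<^sup>2 - 1)/2\<close> this gives
  \<open>R(s) = Q \<integral> exp (z \<phi>(\<tau>) + \<pi>i\<eta>(\<tau> - 1)) / (1 - exp (2\<pi>i\<eta>\<tau>)) d\<tau>/\<tau>\<close>, an integral whose saddle is \<open>\<tau> = 1\<close>.
  By the duplication and reflection formulas \<open>\<chi>(s)\<close> is an elementary multiple of \<open>\<Gamma>(z)\<close>, and turning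
  Euler's integral into the ray \<open>z\<tau>\<^sup>2\<close> gives \<open>\<Gamma>(z) = 2 z\<^sup>z e\<^sup>-\<^sup>z \<integral> exp (2z \<phi>(\<tau>)) d\<tau>/\<tau>\<close>, with the same phase.
  One Laplace estimate, uniform in the sector, handles both integrals; the elementary factors
  agree, and the quotient of the two Gaussian integrals is \<open>e\<^sup>-\<^sup>\<pi>\<^sup>i\<^sup>/\<^sup>8\<close>.
\<close>

section \<open>Primitives along unbounded paths and complex Gaussian integrals\<close>

text \<open>Three obstacles shape the argument. The two rays meet at 0, where sin (pi x) vanishes
  and the branch cut ends; for \<open>Re s \<le> - 1\<close> the power x^(-s) outweighs that zero,
  so the rays may start at 0. Secondly, at the natural width |z|^(-1/2) of the saddle the term pi i
  eta (tau - 1) is of order one, because |eta| is comparable with |z|^(1/2). It cannot be put into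
  the error; completing the square turns it into exp ((pi i eta)^2 / (4 z)), the origin of e^(-pi i
  / 8). Thirdly, the error is relative to a main term that vanishes at the negative even integers.
  Hence both sides are written exactly as a common factor times a saddle integral, and only these
  integrals, whose rescaled leading terms have modulus sqrt pi, are estimated. Contours are moved
  through primitives: improper integrals are limits of differences of one primitive F, and the ends
  of two paths are joined by segments on which length times bound tends to 0.\<close>

lemma LIMSEQ_FTC_exhaustion:
  fixes g F :: "real \<Rightarrow> complex"
  assumes int: "set_integrable lborel A g"
    and deriv: "\<And>x. x \<in> A \<Longrightarrow> (F has_vector_derivative g x) (at x)"
    and cont: "continuous_on A g"
    and le: "\<And>n. l n \<le> u n"
    and sub: "\<And>n. {l n..u n} \<subseteq> A"
    and exh: "\<And>x. x \<in> A \<Longrightarrow> eventually (\<lambda>n. x \<in> {l n..u n}) sequentially"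
  shows "(\<lambda>n. F (u n) - F (l n)) \<longlonglongrightarrow> (LINT x:A|lborel. g x)"
proof -
  have eq: "F (u n) - F (l n) = (LINT x|lborel. indicator {l n..u n} x *\<^sub>R g x)" for n
    using le sub[of n]
    by (intro integral_FTC_Icc[symmetric])
      (auto intro: has_vector_derivative_at_within[OF deriv] continuous_on_subset[OF cont])
  have split: "indicator {l n..u n} x *\<^sub>R g x = indicator {l n..u n} x *\<^sub>R (indicator A x *\<^sub>R g x)" for n x
    using sub[of n] by (auto simp: indicator_def)
  note [measurable] = int[unfolded set_integrable_def, THEN borel_measurable_integrable]
  show ?thesis
    unfolding eq set_lebesgue_integral_def
  proof (rule integral_dominated_convergence[where w = "\<lambda>x. norm (indicator A x *\<^sub>R g x)"])
    show "integrable lborel (\<lambda>x. norm (indicator A x *\<^sub>R g x))"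
      using int unfolding set_integrable_def by (rule integrable_norm)
    show "(\<lambda>x. indicator {l n..u n} x *\<^sub>R g x) \<in> borel_measurable lborel" for n
      unfolding split by measurable
    show "AE x in lborel. (\<lambda>n. indicator {l n..u n} x *\<^sub>R g x) \<longlonglongrightarrow> indicator A x *\<^sub>R g x"
    proof (rule AE_I2, rule tendsto_eventually)
      fix x
      show "eventually (\<lambda>n. indicator {l n..u n} x *\<^sub>R g x = indicator A x *\<^sub>R g x) sequentially"
      proof (cases "x \<in> A")
        case True
        show ?thesis
          using exh[OF True] by eventually_elim (use True in \<open>simp add: indicator_def\<close>)
      next
        case False
        then show ?thesis
          by (subst split) simp
      qed
    qed
    show "AE x in lborel. norm (indicator {l n..u n} x *\<^sub>R g x) \<le> norm (indicator A x *\<^sub>R g x)" for n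
      using sub[of n] by (intro AE_I2) (auto simp: indicator_def)
  qed (use int in \<open>simp add: set_integrable_def\<close>)
qed

lemma LIMSEQ_FTC_UNIV:
  fixes g F :: "real \<Rightarrow> complex"
  assumes "integrable lborel g" "\<And>x. (F has_vector_derivative g x) (at x)" "continuous_on UNIV g"
  shows "(\<lambda>n. F (real n) - F (- real n)) \<longlonglongrightarrow> (LINT x|lborel. g x)"
proof -
  have "\<forall>\<^sub>F n in sequentially. x \<in> {- real n..real n}" for x :: real
  proof -
    have "\<forall>\<^sub>F n in sequentially. \<bar>x\<bar> \<le> real n" by real_asymp
    then show ?thesis by eventually_elim auto
  qed
  then show ?thesis
    using LIMSEQ_FTC_exhaustion[of UNIV g F "\<lambda>n. - real n" real] assms
    by (simp add: set_integrable_def set_lebesgue_integral_def)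
qed

text \<open>The index is \<open>Suc n\<close> because at \<open>n = 0\<close> the lower end 1 / 0 =
  0 would lie outside the open half-line on which F is a primitive.\<close>

lemma LIMSEQ_FTC_Ioi:
  fixes g F :: "real \<Rightarrow> complex"
  assumes "set_integrable lborel {0<..} g"
    and "\<And>x. x > 0 \<Longrightarrow> (F has_vector_derivative g x) (at x)" "continuous_on {0<..} g"
  shows "(\<lambda>n. F (real (Suc n)) - F (1 / real (Suc n))) \<longlonglongrightarrow> (LINT x:{0<..}|lborel. g x)"
proof (rule LIMSEQ_FTC_exhaustion)
  fix x :: real assume "x \<in> {0<..}"
  then have "\<forall>\<^sub>F n in sequentially. 1 / real (Suc n) \<le> x" "\<forall>\<^sub>F n in sequentially. x \<le> real (Suc n)"
    by simp_all real_asymp+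
  then show "\<forall>\<^sub>F n in sequentially. x \<in> {1 / real (Suc n)..real (Suc n)}"
    by eventually_elim auto
next
  show "1 / real (Suc n) \<le> real (Suc n)" for n
    by (simp add: field_simps)
  show "{1 / real (Suc n)..real (Suc n)} \<subseteq> {0<..}" for n
    by (auto intro: less_le_trans[of 0 "1 / real (Suc n)"])
qed (use assms in auto)

text \<open>This plays the role of the closing arc in a contour deformation: once the ends of two
  paths are joined by segments of vanishing contribution, the two improper integrals, both limits of
  differences of the same F, agree.\<close>

lemma primitive_diff_tendsto_0:
  fixes F f :: "complex \<Rightarrow> complex"
  assumes F: "\<And>x. x \<in> S \<Longrightarrow> (F has_field_derivative f x) (at x)"
    and bound: "eventually (\<lambda>n. \<forall>x \<in> closed_segment (p n) (q n). x \<in> S \<and> norm (f x) \<le> B n) sequentially"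
    and lim: "(\<lambda>n. B n * norm (p n - q n)) \<longlonglongrightarrow> 0"
  shows "(\<lambda>n. F (p n) - F (q n)) \<longlonglongrightarrow> 0"
proof (rule Lim_null_comparison[OF _ lim])
  show "\<forall>\<^sub>F n in sequentially. norm (F (p n) - F (q n)) \<le> B n * norm (p n - q n)"
    using bound
  proof eventually_elim
    case (elim n)
    then show ?case
      by (intro field_differentiable_bound[of "closed_segment (p n) (q n)" F f])
        (auto intro: has_field_derivative_at_within F)
  qed
qed

section \<open>Gaussian integrals with complex parameters\<close>

lemma integrable_exp_minus_square: "integrable lborel (\<lambda>x::real. exp (- x\<^sup>2))"
  and integral_exp_minus_square: "(LINT x|lborel. exp (- x\<^sup>2)) = sqrt pi"
proof -
  have "has_bochner_integral lborel (\<lambda>x. exp (- x\<^sup>2) :: real) (sqrt pi)"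
    using has_bochner_integral_even_function[OF gaussian_moment_0] by simp
  then show "integrable lborel (\<lambda>x::real. exp (- x\<^sup>2))" "(LINT x|lborel. exp (- x\<^sup>2)) = sqrt pi"
    by (auto simp: has_bochner_integral_iff)
qed

lemma integrable_gaussian_tilt:
  fixes L c :: real
  assumes "c > 0"
  shows "integrable lborel (\<lambda>y::real. exp (L * \<bar>y\<bar> - c * y\<^sup>2))"
proof (rule Bochner_Integration.integrable_bound)
  show "integrable lborel (\<lambda>y::real. exp (L\<^sup>2 / (2 * c)) * exp (- (0 + sqrt (c / 2) * y)\<^sup>2))"
    using assms lborel_integrable_real_affine[OF integrable_exp_minus_square, of "sqrt (c / 2)" 0]
    by simp
  have "L * \<bar>y\<bar> - c * y\<^sup>2 \<le> L\<^sup>2 / (2 * c) + - (0 + sqrt (c / 2) * y)\<^sup>2" for y :: real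
  proof -
    have "0 \<le> (c * \<bar>y\<bar> - L)\<^sup>2 / (2 * c)" using assms by simp
    also have "\<dots> = c / 2 * y\<^sup>2 - L * \<bar>y\<bar> + L\<^sup>2 / (2 * c)"
      using assms by (simp add: power2_diff power_mult_distrib add_divide_distrib diff_divide_distrib)
        (simp add: field_simps power2_eq_square)
    finally show ?thesis using assms by (simp add: power_mult_distrib)
  qed
  then show "AE y in lborel. norm (exp (L * \<bar>y\<bar> - c * y\<^sup>2))
      \<le> norm (exp (L\<^sup>2 / (2 * c)) * exp (- (0 + sqrt (c / 2) * y)\<^sup>2))"
    by (simp flip: exp_add)
qed simp

lemma integrable_complex_gaussian:
  assumes "Re \<omega> > 0"
  shows "integrable lborel (\<lambda>y::real. exp (- \<omega> * of_real y ^ 2 + \<mu> * of_real y))"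
proof (rule Bochner_Integration.integrable_bound[OF integrable_gaussian_tilt[OF assms, of "\<bar>Re \<mu>\<bar>"]])
  have "Re \<mu> * y \<le> \<bar>Re \<mu>\<bar> * \<bar>y\<bar>" for y by (metis abs_ge_self abs_mult)
  then show "AE y in lborel. norm (exp (- \<omega> * of_real y ^ 2 + \<mu> * of_real y))
      \<le> norm (exp (\<bar>Re \<mu>\<bar> * \<bar>y\<bar> - Re \<omega> * y\<^sup>2))"
    by (auto simp: power2_eq_square mult.assoc)
qed simp

text \<open>With q the principal root of \<omega> and d = \<mu> / (2 q), completing the square gives
  exp (- w^2) along the line w = q y - d. An entire primitive moves this line to the real axis;
  since Re q is nonnegative, right end goes to right end and the sign of the root is the correct
  one.\<close>

lemma integral_complex_gaussian:
  assumes \<omega>: "Re \<omega> > 0"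
  shows "(LINT y|lborel. exp (- \<omega> * of_real y ^ 2 + \<mu> * of_real y)) =
    of_real (sqrt pi) / csqrt \<omega> * exp (\<mu>\<^sup>2 / (4 * \<omega>))"
proof -
  define q where "q = csqrt \<omega>"
  have q2: "q\<^sup>2 = \<omega>" by (simp add: q_def)
  have "\<omega> \<noteq> 0" using \<omega> by auto
  then have q0: "q \<noteq> 0" and Req: "Re q \<ge> 0" unfolding q_def using Re_csqrt[of \<omega>] by auto
  define d where "d = \<mu> / (2 * q)"
  define f where "f = (\<lambda>w::complex. exp (- w\<^sup>2))"
  have "f holomorphic_on UNIV" unfolding f_def by (intro holomorphic_intros)
  then obtain F where F: "\<And>x. (F has_field_derivative f x) (at x)"
    using holomorphic_convex_primitive'[of UNIV f] by auto
  have int1: "integrable lborel (\<lambda>y::real. f (of_real y))"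
    using integrable_complex_gaussian[of 1 0] by (simp add: f_def)
  have f_path: "f (q * of_real y - d) = exp (- \<omega> * of_real y ^ 2 + \<mu> * of_real y) * exp (- (\<mu>\<^sup>2 / (4 * \<omega>)))" for y
  proof -
    have "- (q * of_real y - d)\<^sup>2 = - \<omega> * of_real y ^ 2 + \<mu> * of_real y + - (\<mu>\<^sup>2 / (4 * \<omega>))"
      using q0 unfolding d_def q2[symmetric] by (simp add: power2_eq_square field_simps)
    then show ?thesis unfolding f_def by (simp only: exp_add)
  qed
  have int2: "integrable lborel (\<lambda>y::real. f (q * of_real y - d) * q)"
    unfolding f_path using integrable_complex_gaussian[OF \<omega>] by (intro integrable_mult_left) auto
  have lim1: "(\<lambda>n. F (of_real (real n)) - F (of_real (- real n))) \<longlonglongrightarrow> (LINT y|lborel. f (of_real y))"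
  proof (rule LIMSEQ_FTC_UNIV[OF int1])
    show "((\<lambda>y. F (of_real y)) has_vector_derivative f (of_real y)) (at y)" for y
      by (rule has_vector_derivative_real_field[OF F])
  qed (auto simp: f_def intro!: continuous_intros)
  have lim2: "(\<lambda>n. F (q * of_real (real n) - d) - F (q * of_real (- real n) - d))
      \<longlonglongrightarrow> (LINT y|lborel. f (q * of_real y - d) * q)"
  proof (rule LIMSEQ_FTC_UNIV[OF int2])
    show "((\<lambda>y. F (q * of_real y - d)) has_vector_derivative f (q * of_real y - d) * q) (at y)" for y
    proof -
      have "((\<lambda>y. F (q * y - d)) has_field_derivative f (q * of_real y - d) * q) (at (of_real y))"
        by (rule DERIV_chain2[OF F]) (auto intro!: derivative_eq_intros)
      then show ?thesis by (rule has_vector_derivative_real_field)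
    qed
  qed (auto simp: f_def intro!: continuous_intros)
  \<comment> \<open>A point of the segment joining the lines at height T is
    \<open>T * p - e\<close>, with p between q and 1. In \<open>Re (p\<^sup>2)\<close> the cross
    term is nonnegative, and (1 - u)^2 + u^2 is at least 1/2, which explains the halving in b. K
    dominates the product of the norms of p and e.\<close>
  define b where "b = min 1 (Re \<omega>) / 2"
  define K where "K = (1 + norm q) * norm d"
  have b: "b > 0" using \<omega> by (simp add: b_def)
  have fbound: "norm (f w) \<le> exp (- b * T\<^sup>2 + 2 * \<bar>T\<bar> * K + (norm d)\<^sup>2)"
    if "w \<in> closed_segment (q * of_real T - d) (of_real T)" for w and T :: real
  proof -
    from that obtain u where u: "0 \<le> u" "u \<le> 1"
      and w: "w = (1 - u) *\<^sub>R (q * of_real T - d) + u *\<^sub>R of_real T"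
      unfolding closed_segment_def by auto
    define p where "p = (1 - u) *\<^sub>R q + of_real u"
    define e where "e = (1 - u) *\<^sub>R d"
    have w': "w = of_real T * p - e"
      unfolding w p_def e_def by (simp add: scaleR_conv_of_real algebra_simps)
    have Rep: "Re (p\<^sup>2) \<ge> b"
    proof -
      have "Re (q\<^sup>2) = Re q * Re q - Im q * Im q" by (simp add: power2_eq_square)
      then have *: "Re \<omega> = Re q * Re q - Im q * Im q" by (simp add: q2)
      have "Re (p\<^sup>2) = (1 - u)\<^sup>2 * Re \<omega> + 2 * u * (1 - u) * Re q + u\<^sup>2"
        unfolding p_def * by (simp add: power2_eq_square algebra_simps)
      moreover have "2 * u * (1 - u) * Re q \<ge> 0" using u Req by simp
      moreover have "(1 - u)\<^sup>2 * Re \<omega> \<ge> (1 - u)\<^sup>2 * (2 * b)" "u\<^sup>2 * 1 \<ge> u\<^sup>2 * (2 * b)"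
        by (intro mult_left_mono; simp add: b_def)+
      moreover have "(1 - u)\<^sup>2 * (2 * b) + u\<^sup>2 * (2 * b) = b + b * (1 - 2 * u)\<^sup>2"
        by (simp add: power2_eq_square algebra_simps)
      moreover have "b * (1 - 2 * u)\<^sup>2 \<ge> 0" using b by simp
      ultimately show ?thesis by linarith
    qed
    have np: "norm p \<le> 1 + norm q"
    proof -
      have "norm p \<le> norm ((1 - u) *\<^sub>R q) + norm (of_real u :: complex)"
        unfolding p_def by (rule norm_triangle_ineq)
      also have "\<dots> \<le> norm q + 1"
        using u mult_left_le_one_le[of "norm q" "1 - u"] by simp
      finally show ?thesis by simp
    qed
    have ne: "norm e \<le> norm d"
      unfolding e_def using u by (simp add: mult_left_le_one_le)
    have "Re (w\<^sup>2) = T\<^sup>2 * Re (p\<^sup>2) - 2 * T * Re (p * e) + Re (e\<^sup>2)"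
      unfolding w' by (simp add: power2_eq_square algebra_simps)
    moreover have "T\<^sup>2 * Re (p\<^sup>2) \<ge> T\<^sup>2 * b" using Rep by (intro mult_left_mono) auto
    moreover have "\<bar>2 * T * Re (p * e)\<bar> \<le> 2 * \<bar>T\<bar> * K"
    proof -
      have "\<bar>Re (p * e)\<bar> \<le> norm (p * e)" by (rule abs_Re_le_cmod)
      also have "\<dots> \<le> K" unfolding norm_mult K_def by (intro mult_mono np ne) auto
      finally show ?thesis by (simp add: abs_mult mult_left_mono)
    qed
    moreover have "\<bar>Re (e\<^sup>2)\<bar> \<le> (norm d)\<^sup>2"
    proof -
      have "\<bar>Re (e\<^sup>2)\<bar> \<le> norm (e\<^sup>2)" by (rule abs_Re_le_cmod)
      also have "\<dots> \<le> (norm d)\<^sup>2" unfolding norm_power by (intro power_mono ne) auto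
      finally show ?thesis .
    qed
    ultimately have "- Re (w\<^sup>2) \<le> - b * T\<^sup>2 + 2 * \<bar>T\<bar> * K + (norm d)\<^sup>2"
      unfolding abs_le_iff mult.commute[of "T\<^sup>2" b] by linarith
    then show ?thesis unfolding f_def norm_exp_eq_Re by simp
  qed
  have lim0: "(\<lambda>n. F (q * of_real (\<epsilon> * real n) - d) - F (of_real (\<epsilon> * real n))) \<longlonglongrightarrow> 0"
    if \<epsilon>: "\<bar>\<epsilon>\<bar> = 1" for \<epsilon> :: real
  proof (rule primitive_diff_tendsto_0[where S = UNIV, OF F])
    let ?B = "\<lambda>n. exp (- b * (\<epsilon> * real n)\<^sup>2 + 2 * \<bar>\<epsilon> * real n\<bar> * K + (norm d)\<^sup>2)"
    show "\<forall>\<^sub>F n in sequentially. \<forall>x\<in>closed_segment (q * of_real (\<epsilon> * real n) - d) (of_real (\<epsilon> * real n)).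
       x \<in> UNIV \<and> norm (f x) \<le> ?B n"
      using fbound by auto
    have eps2: "\<epsilon>\<^sup>2 = 1" using \<epsilon> by (metis power2_abs power_one)
    show "(\<lambda>n. ?B n * norm (q * of_real (\<epsilon> * real n) - d - of_real (\<epsilon> * real n))) \<longlonglongrightarrow> 0"
    proof (rule Lim_null_comparison)
      show "(\<lambda>n. exp (- b * (real n)\<^sup>2 + 2 * real n * K + (norm d)\<^sup>2) * (norm (q - 1) * real n + norm d)) \<longlonglongrightarrow> 0"
        using b by real_asymp
      have "norm (q * of_real (\<epsilon> * real n) - d - of_real (\<epsilon> * real n)) \<le> norm (q - 1) * real n + norm d" for n
      proof -
        have "q * of_real (\<epsilon> * real n) - d - of_real (\<epsilon> * real n) = (q - 1) * of_real (\<epsilon> * real n) - d"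
          by (simp add: algebra_simps)
        also have "norm \<dots> \<le> norm ((q - 1) * of_real (\<epsilon> * real n)) + norm d" by (rule norm_triangle_ineq4)
        also have "\<dots> = norm (q - 1) * real n + norm d" using \<epsilon> by (simp add: norm_mult abs_mult)
        finally show ?thesis .
      qed
      then show "\<forall>\<^sub>F n in sequentially. norm (?B n * norm (q * of_real (\<epsilon> * real n) - d - of_real (\<epsilon> * real n)))
          \<le> exp (- b * (real n)\<^sup>2 + 2 * real n * K + (norm d)\<^sup>2) * (norm (q - 1) * real n + norm d)"
        using \<epsilon> eps2 by (auto simp: abs_mult power_mult_distrib intro!: always_eventually mult_left_mono)
    qed
  qed
  have "(\<lambda>n. (F (q * of_real (real n) - d) - F (q * of_real (- real n) - d))
        - (F (of_real (real n)) - F (of_real (- real n)))) \<longlonglongrightarrow> 0"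
    using tendsto_diff[OF lim0[of 1] lim0[of "-1"]] by (simp add: algebra_simps)
  moreover have "(\<lambda>n. (F (q * of_real (real n) - d) - F (q * of_real (- real n) - d))
        - (F (of_real (real n)) - F (of_real (- real n)))) \<longlonglongrightarrow>
        (LINT y|lborel. f (q * of_real y - d) * q) - (LINT y|lborel. f (of_real y))"
    by (rule tendsto_diff[OF lim2 lim1])
  ultimately have "(LINT y|lborel. f (q * of_real y - d) * q) = (LINT y|lborel. f (of_real y))"
    using LIMSEQ_unique by fastforce
  also have "(LINT y|lborel. f (of_real y)) = of_real (sqrt pi)"
  proof -
    have "f (of_real y) = of_real (exp (- y\<^sup>2))" for y by (simp add: f_def flip: exp_of_real)
    then show ?thesis by (simp add: integral_exp_minus_square del: of_real_exp)
  qed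
  finally have "(LINT y|lborel. exp (- \<omega> * of_real y ^ 2 + \<mu> * of_real y)) * exp (- (\<mu>\<^sup>2 / (4 * \<omega>))) * q = of_real (sqrt pi)"
    unfolding f_path by simp
  then show ?thesis
    using q0 unfolding q_def[symmetric] by (simp add: exp_minus field_simps)
qed

section \<open>A uniform Laplace estimate\<close>

text \<open>Normalised so that value and first derivative vanish at the saddle 1. The second
  derivative there is -2, so the model Gaussian is exp (- \<kappa> (\<tau> - 1)^2).\<close>

definition saddle_phase :: "real \<Rightarrow> real" where
  "saddle_phase \<tau> = ln \<tau> - (\<tau>\<^sup>2 - 1) / 2"

text \<open>From ln \<tau> \<le> \<tau> - 1. Half of the true curvature is given away in exchange
  for validity on the whole ray.\<close>

lemma saddle_phase_le: "\<tau> > 0 \<Longrightarrow> saddle_phase \<tau> \<le> - (\<tau> - 1)\<^sup>2 / 2"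
  using ln_le_minus_one[of \<tau>] by (simp add: saddle_phase_def power2_eq_square field_simps)

text \<open>The function inside the absolute value vanishes at 1 and has derivative (x - 1)^2 / x,
  which is at most 2 (\<tau> - 1)^2 between 1 and \<tau> because x \<ge> 1/2 there.\<close>

lemma saddle_phase_quadratic_approx:
  assumes "\<tau> \<ge> 1 / 2"
  shows "\<bar>saddle_phase \<tau> + (\<tau> - 1)\<^sup>2\<bar> \<le> 2 * \<bar>\<tau> - 1\<bar> ^ 3"
proof -
  let ?h = "\<lambda>x. saddle_phase x + (x - 1)\<^sup>2"
  have "norm (?h \<tau> - ?h 1) \<le> 2 * (\<tau> - 1)\<^sup>2 * norm (\<tau> - 1)"
  proof (rule field_differentiable_bound[where S = "closed_segment 1 \<tau>" and f' = "\<lambda>x. (x - 1)\<^sup>2 / x"])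
    fix x assume "x \<in> closed_segment 1 \<tau>"
    then have x: "x \<ge> 1 / 2" "\<bar>x - 1\<bar> \<le> \<bar>\<tau> - 1\<bar>"
      using assms by (auto simp: closed_segment_eq_real_ivl split: if_splits)
    show "(?h has_field_derivative (x - 1)\<^sup>2 / x) (at x within closed_segment 1 \<tau>)"
      unfolding saddle_phase_def using x
      by (auto intro!: derivative_eq_intros simp: field_simps power2_eq_square)
    have "(x - 1)\<^sup>2 / x \<le> (\<tau> - 1)\<^sup>2 / (1 / 2)"
      using x by (intro frac_le) (auto simp: abs_le_square_iff)
    then show "norm ((x - 1)\<^sup>2 / x) \<le> 2 * (\<tau> - 1)\<^sup>2"
      using x by simp
  qed auto
  then show ?thesis
    by (simp add: saddle_phase_def power2_eq_square power3_eq_cube mult.assoc)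
qed

lemma norm_exp_diff_le:
  fixes a b :: complex
  assumes "Re a \<le> r" "Re b \<le> r"
  shows "norm (exp a - exp b) \<le> exp r * norm (a - b)"
proof (rule field_differentiable_bound[where S = "{z. Re z \<le> r}" and f' = exp])
  show "convex {z. Re z \<le> r}" by (rule convex_halfspace_Re_le)
qed (use assms in \<open>auto intro!: derivative_eq_intros\<close>)

text \<open>A small power of the exponential absorbs the singularity at \<open>\<tau> = 0\<close>, at the cost of halving the
  Gaussian exponent; this keeps the error bound free of case distinctions near 0.\<close>

lemma exp_saddle_phase_over_square:
  assumes "\<tau> > 0" "a \<ge> 4"
  shows "exp (a * saddle_phase \<tau>) / \<tau>\<^sup>2 \<le> 3 * exp (- a * (\<tau> - 1)\<^sup>2 / 4)"
proof -
  \<comment> \<open>Two copies of the phase are set aside, since their exponential carries the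
    factor \<open>\<tau>\<^sup>2\<close>. The remaining a - 2 still yields the exponent a / 4
    exactly when a \<ge> 4.\<close>
  have "(a - 2) * saddle_phase \<tau> \<le> (a - 2) * (- (\<tau> - 1)\<^sup>2 / 2)"
    using assms by (intro mult_left_mono saddle_phase_le) auto
  also have "\<dots> \<le> - a * (\<tau> - 1)\<^sup>2 / 4"
    using mult_right_mono[of 4 a "(\<tau> - 1)\<^sup>2"] assms by (simp add: algebra_simps)
  finally have 1: "exp ((a - 2) * saddle_phase \<tau>) \<le> exp (- a * (\<tau> - 1)\<^sup>2 / 4)" by simp
  have "exp (2 * saddle_phase \<tau>) = \<tau>\<^sup>2 * exp (1 - \<tau>\<^sup>2)"
  proof -
    have "2 * saddle_phase \<tau> = ln \<tau> + ln \<tau> + (1 - \<tau>\<^sup>2)" by (simp add: saddle_phase_def field_simps)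
    then show ?thesis using assms by (simp only: exp_add exp_ln power2_eq_square)
  qed
  also have "\<dots> \<le> \<tau>\<^sup>2 * 3"
    using exp_le by (intro mult_left_mono order.trans[OF _ exp_le]) auto
  finally have 2: "exp (2 * saddle_phase \<tau>) \<le> \<tau>\<^sup>2 * 3" .
  have "exp (a * saddle_phase \<tau>) = exp (2 * saddle_phase \<tau>) * exp ((a - 2) * saddle_phase \<tau>)"
    by (simp flip: exp_add add: algebra_simps)
  also have "\<dots> \<le> (\<tau>\<^sup>2 * 3) * exp (- a * (\<tau> - 1)\<^sup>2 / 4)"
    using 1 2 by (intro mult_mono) auto
  finally show ?thesis using assms by (simp add: field_simps)
qed

lemma exp_saddle_phase_over:
  assumes "\<tau> > 0" "a \<ge> 4"
  shows "exp (a * saddle_phase \<tau>) / \<tau> \<le> 2 * exp (- a * (\<tau> - 1)\<^sup>2 / 4)"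
proof -
  have "(a - 1) * saddle_phase \<tau> \<le> (a - 1) * (- (\<tau> - 1)\<^sup>2 / 2)"
    using assms by (intro mult_left_mono saddle_phase_le) auto
  also have "\<dots> \<le> - a * (\<tau> - 1)\<^sup>2 / 4"
    using mult_right_mono[of 2 a "(\<tau> - 1)\<^sup>2"] assms by (simp add: algebra_simps)
  finally have 1: "exp ((a - 1) * saddle_phase \<tau>) \<le> exp (- a * (\<tau> - 1)\<^sup>2 / 4)" by simp
  have "exp (saddle_phase \<tau>) = \<tau> * exp ((1 - \<tau>\<^sup>2) / 2)"
    using assms by (simp add: saddle_phase_def exp_diff diff_divide_distrib)
  also have "\<dots> \<le> \<tau> * 2"
  proof -
    have "exp ((1 - \<tau>\<^sup>2) / 2) \<le> exp (1 / 2 :: real)" by simp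
    also have "\<dots> \<le> 2" using exp_bound_half[of "1/2::real"] by simp
    finally show ?thesis using assms by (intro mult_left_mono) auto
  qed
  finally have 2: "exp (saddle_phase \<tau>) \<le> \<tau> * 2" .
  have "exp (a * saddle_phase \<tau>) = exp (saddle_phase \<tau>) * exp ((a - 1) * saddle_phase \<tau>)"
    by (simp flip: exp_add add: algebra_simps)
  also have "\<dots> \<le> (\<tau> * 2) * exp (- a * (\<tau> - 1)\<^sup>2 / 4)"
    using 1 2 assms by (intro mult_mono) auto
  finally show ?thesis using assms by (simp add: field_simps)
qed

text \<open>The pointwise form of Laplace's method at scale y = \<rho> (\<tau> - 1): every error is
  O(1 / \<rho>) times a polynomial in y times a Gaussian with a quarter of the decay. Where \<tau>
  \<le> 0 the integrand is extended by 0; there |y| \<ge> \<rho>, so the model Gaussian alone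
  already fits the bound.\<close>

lemma saddle_integrand_approx:
  fixes \<rho> y c L M :: real and \<omega> \<mu> :: complex and m :: "real \<Rightarrow> complex"
  assumes "M \<ge> 0" "\<rho> > 0" "norm \<omega> = 1" "Re \<omega> \<ge> c" "c * \<rho>\<^sup>2 \<ge> 4" "norm \<mu> \<le> L"
    and m: "\<And>\<tau>. \<tau> > 0 \<Longrightarrow> norm (m \<tau> - 1) \<le> M / (\<rho> * \<tau>)"
  defines "\<tau> \<equiv> 1 + y / \<rho>"
  shows "norm ((if \<tau> > 0 then exp (\<omega> * \<rho>\<^sup>2 * saddle_phase \<tau> + \<mu> * y) * m \<tau> / \<tau> else 0)
           - exp (- \<omega> * of_real y ^ 2 + \<mu> * of_real y))
         \<le> (3 * M + 6 * \<bar>y\<bar> + 2 * \<bar>y\<bar> ^ 3) / \<rho> * exp (L * \<bar>y\<bar> - c / 4 * y\<^sup>2)"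
proof -
  define a where "a = Re \<omega> * \<rho>\<^sup>2"
  define v where "v = \<tau> - 1"
  have v: "v = y / \<rho>" by (simp add: v_def \<tau>_def)
  have a4: "a \<ge> 4"
    using assms(4) mult_right_mono[of c "Re \<omega>" "\<rho>\<^sup>2"] assms(5) by (simp add: a_def)
  define E where "E = exp (- a * v\<^sup>2 / 4)"
  have av: "a * v\<^sup>2 = Re \<omega> * y\<^sup>2"
    using assms(2) by (simp add: a_def v power_divide)
  have E_le: "E \<le> exp (- (c / 4 * y\<^sup>2))"
    unfolding E_def using av mult_right_mono[OF assms(4), of "y\<^sup>2"] by simp
  have emu: "norm (exp (\<mu> * y)) \<le> exp (L * \<bar>y\<bar>)"
  proof -
    have "Re (\<mu> * y) \<le> norm (\<mu> * y)" by (rule complex_Re_le_cmod)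
    also have "\<dots> \<le> L * \<bar>y\<bar>" using assms(6) by (simp add: norm_mult mult_right_mono)
    finally show ?thesis by (simp only: norm_exp_eq_Re exp_le_cancel_iff)
  qed
  define Y where "Y = exp (- \<omega> * of_real y ^ 2)"
  have nY: "norm Y = exp (- a * v\<^sup>2)"
    unfolding Y_def norm_exp_eq_Re using av by (simp flip: of_real_power)
  have nY_le: "norm Y \<le> E" unfolding nY E_def using a4 by (simp add: field_simps)
  have E0: "E \<ge> 0" by (simp add: E_def)
  define P where "P = (3 * M + 6 * \<bar>y\<bar> + 2 * \<bar>y\<bar> ^ 3) / \<rho>"
  have P0: "P \<ge> 0" unfolding P_def using assms by auto
  define X where "X = (if \<tau> > 0 then exp (\<omega> * \<rho>\<^sup>2 * saddle_phase \<tau>) * m \<tau> / \<tau> else 0)"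
  have key: "norm (X - Y) \<le> P * E"
  proof (cases "\<tau> > 0")
    case False
    then have "1 \<le> \<bar>y\<bar> / \<rho>" using assms(2) by (simp add: \<tau>_def field_simps)
    also have "\<dots> \<le> P" unfolding P_def using assms by (intro divide_right_mono) auto
    finally have "1 * E \<le> P * E" using E0 by (rule mult_right_mono)
    then show ?thesis using False nY_le by (simp add: X_def)
  next
    case True
    define Z where "Z = exp (\<omega> * \<rho>\<^sup>2 * saddle_phase \<tau>)"
    have nZ: "norm Z = exp (a * saddle_phase \<tau>)"
      unfolding Z_def norm_exp_eq_Re a_def by (simp flip: of_real_power of_real_mult)
    have ph: "a * saddle_phase \<tau> \<le> - a * v\<^sup>2 / 2"
      using mult_left_mono[OF saddle_phase_le[OF True], of a] a4 by (simp add: v_def)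
    have X: "X = Z * m \<tau> / \<tau>" using True by (simp add: X_def Z_def)
    \<comment> \<open>The three errors come from replacing the amplitude m by 1, the factor 1 /
      \<tau> by 1, and the phase by its quadratic part.\<close>
    have split: "X - Y = Z * (m \<tau> - 1) / \<tau> + Z / \<tau> * of_real (- v) + (Z - Y)"
      using True by (simp add: X v_def field_simps)
    have t1: "norm (Z * (m \<tau> - 1) / \<tau>) \<le> 3 * M / \<rho> * E"
    proof -
      have "norm (Z * (m \<tau> - 1) / \<tau>) \<le> norm Z * (M / (\<rho> * \<tau>)) / \<tau>"
        unfolding norm_divide norm_mult norm_of_real using m[OF True] True
        by (simp only: abs_of_pos) (intro divide_right_mono mult_left_mono; simp)
      also have "\<dots> = M / \<rho> * (exp (a * saddle_phase \<tau>) / \<tau>\<^sup>2)"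
        using True by (simp add: nZ power2_eq_square mult_ac)
      also have "\<dots> \<le> M / \<rho> * (3 * E)"
        unfolding E_def v_def using assms True a4
        by (intro mult_left_mono exp_saddle_phase_over_square) auto
      finally show ?thesis by (simp add: mult_ac)
    qed
    have t2: "norm (Z / \<tau> * of_real (- v)) \<le> 2 * \<bar>y\<bar> / \<rho> * E"
    proof -
      have "norm (Z / \<tau> * of_real (- v)) = exp (a * saddle_phase \<tau>) / \<tau> * \<bar>v\<bar>"
        using True by (simp add: norm_mult norm_divide nZ)
      also have "\<dots> \<le> 2 * E * \<bar>v\<bar>"
        unfolding E_def v_def using assms True a4
        by (intro mult_right_mono exp_saddle_phase_over) auto
      also have "\<dots> = 2 * \<bar>y\<bar> / \<rho> * E" using assms by (simp add: v)
      finally show ?thesis .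
    qed
    have t3: "norm (Z - Y) \<le> (4 * \<bar>y\<bar> + 2 * \<bar>y\<bar> ^ 3) / \<rho> * E"
    proof (cases "\<tau> \<ge> 1 / 2")
      case half: True
      have avn: "0 \<le> a * v\<^sup>2" using a4 by simp
      have "norm (Z - Y) \<le> exp (- a * v\<^sup>2 / 2) * norm (\<omega> * \<rho>\<^sup>2 * saddle_phase \<tau> - - \<omega> * of_real y ^ 2)"
        unfolding Z_def Y_def
      proof (rule norm_exp_diff_le)
        show "Re (\<omega> * \<rho>\<^sup>2 * saddle_phase \<tau>) \<le> - a * v\<^sup>2 / 2"
          using ph by (simp add: a_def flip: of_real_power of_real_mult)
        have "Re (- \<omega> * of_real y ^ 2) = - (a * v\<^sup>2)"
          using av by (simp flip: of_real_power)
        then show "Re (- \<omega> * of_real y ^ 2) \<le> - a * v\<^sup>2 / 2"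
          using avn by simp
      qed
      also have "\<omega> * \<rho>\<^sup>2 * saddle_phase \<tau> - - \<omega> * of_real y ^ 2
          = \<omega> * of_real (\<rho>\<^sup>2 * (saddle_phase \<tau> + (\<tau> - 1)\<^sup>2))"
        using assms(2) v unfolding v_def[symmetric] by (simp add: power_divide algebra_simps)
      also have "norm \<dots> = \<rho>\<^sup>2 * \<bar>saddle_phase \<tau> + (\<tau> - 1)\<^sup>2\<bar>"
        using assms(3) by (simp add: norm_mult abs_mult del: of_real_mult of_real_add of_real_power)
      also have "exp (- a * v\<^sup>2 / 2) * \<dots> \<le> E * (\<rho>\<^sup>2 * (2 * \<bar>\<tau> - 1\<bar> ^ 3))"
        unfolding E_def using avn half
        by (intro mult_mono saddle_phase_quadratic_approx) auto
      also have "\<dots> = 2 * \<bar>y\<bar> ^ 3 / \<rho> * E"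
        using assms(2) v unfolding v_def[symmetric]
        by (simp add: power_divide power2_eq_square power3_eq_cube)
      also have "\<dots> \<le> (4 * \<bar>y\<bar> + 2 * \<bar>y\<bar> ^ 3) / \<rho> * E"
        using assms(2) E0 by (intro mult_right_mono divide_right_mono) auto
      finally show ?thesis .
    next
      \<comment> \<open>Away from the saddle there is no cancellation to exploit: both terms are
        bounded by E, and |v| > 1/2 makes 2 at most 4 |y| / \<rho>. This is the source of the term 4
        |y|.\<close>
      case False
      have "norm (Z - Y) \<le> norm Z + norm Y" by (rule norm_triangle_ineq4)
      also have "norm Z \<le> E"
      proof -
        have "0 \<le> a * v\<^sup>2" using a4 by simp
        then show ?thesis unfolding nZ E_def using ph by simp
      qed
      also have "E + norm Y \<le> 2 * E" using nY_le by simp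
      also have "\<dots> \<le> (4 * \<bar>y\<bar> + 2 * \<bar>y\<bar> ^ 3) / \<rho> * E"
      proof (rule mult_right_mono[OF _ E0])
        have "\<tau> - 1 \<le> - 1 / 2" using False by simp
        then have "2 \<le> 4 * \<bar>v\<bar>" by (simp add: v_def)
        also have "\<dots> \<le> (4 * \<bar>y\<bar> + 2 * \<bar>y\<bar> ^ 3) / \<rho>"
          using assms(2) by (simp add: v divide_right_mono)
        finally show "2 \<le> (4 * \<bar>y\<bar> + 2 * \<bar>y\<bar> ^ 3) / \<rho>" .
      qed
      finally show ?thesis by simp
    qed
    have "norm (X - Y) \<le> norm (Z * (m \<tau> - 1) / \<tau>) + norm (Z / \<tau> * of_real (- v)) + norm (Z - Y)"
      unfolding split by (intro norm_triangle_le add_mono order.refl)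
    also have "\<dots> \<le> 3 * M / \<rho> * E + 2 * \<bar>y\<bar> / \<rho> * E + (4 * \<bar>y\<bar> + 2 * \<bar>y\<bar> ^ 3) / \<rho> * E"
      by (intro add_mono t1 t2 t3)
    also have "\<dots> = P * E" by (simp add: P_def add_divide_distrib algebra_simps)
    finally show ?thesis .
  qed
  have "(if \<tau> > 0 then exp (\<omega> * \<rho>\<^sup>2 * saddle_phase \<tau> + \<mu> * y) * m \<tau> / \<tau> else 0)
      - exp (- \<omega> * of_real y ^ 2 + \<mu> * of_real y) = exp (\<mu> * y) * (X - Y)"
    by (simp only: X_def Y_def exp_add) (simp add: algebra_simps)
  also have "norm \<dots> \<le> exp (L * \<bar>y\<bar>) * (P * exp (- (c / 4 * y\<^sup>2)))"
    unfolding norm_mult using key E_le P0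
    by (intro mult_mono emu) (auto intro: order.trans mult_left_mono)
  also have "\<dots> = P * exp (L * \<bar>y\<bar> - c / 4 * y\<^sup>2)"
    by (simp only: exp_diff exp_minus divide_inverse mult_ac)
  finally show ?thesis unfolding P_def .
qed

text \<open>C is fixed before \<kappa>, l and m, which is what makes the expansion uniform in the
  sector. The linear coefficient l may grow like the square root of |\<kappa>|, hence the factor
  \<open>exp (l\<^sup>2 / (4 * \<kappa>))\<close> in the leading term. The amplitude may deviate
  from 1 like 1 / \<tau> near 0, as the factor 1 / (1 - exp (2 pi i eta \<tau>)) does. Integrability
  is concluded as well because the rotations of contours assume it.\<close>

lemma saddle_ray_integral:
  fixes c L M :: real
  assumes "c > 0" "M \<ge> 0"
  obtains C where "\<And>(\<kappa> :: complex) (l :: complex) (m :: real \<Rightarrow> complex). c * norm \<kappa> \<le> Re \<kappa> \<Longrightarrow> 4 \<le> c * norm \<kappa> \<Longrightarrow> norm l \<le> L * sqrt (norm \<kappa>) \<Longrightarrow>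
      continuous_on {0<..} m \<Longrightarrow> (\<And>\<tau>. \<tau> > 0 \<Longrightarrow> norm (m \<tau> - 1) \<le> M / (sqrt (norm \<kappa>) * \<tau>)) \<Longrightarrow>
      set_integrable lborel {0<..} (\<lambda>\<tau>. exp (\<kappa> * saddle_phase \<tau> + l * (of_real \<tau> - 1)) * m \<tau> / \<tau>) \<and>
      norm (sqrt (norm \<kappa>) * (LINT \<tau>:{0<..}|lborel. exp (\<kappa> * saddle_phase \<tau> + l * (of_real \<tau> - 1)) * m \<tau> / \<tau>)
        - sqrt pi / csqrt (\<kappa> / norm \<kappa>) * exp (l\<^sup>2 / (4 * \<kappa>))) \<le> C / sqrt (norm \<kappa>)"
proof -
  define W where "W = (\<lambda>y::real. exp ((L + 1) * \<bar>y\<bar> - c / 4 * y\<^sup>2))"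
  define C where "C = (3 * M + 60) * (LINT y|lborel. W y)"
  have W: "integrable lborel W"
    unfolding W_def using assms by (intro integrable_gaussian_tilt) auto
  show thesis
  proof (rule that[of C])
    fix \<kappa> l :: complex and m :: "real \<Rightarrow> complex"
    assume \<kappa>: "c * norm \<kappa> \<le> Re \<kappa>" "4 \<le> c * norm \<kappa>" and l: "norm l \<le> L * sqrt (norm \<kappa>)"
      and cont: "continuous_on {0<..} m"
      and m: "\<And>\<tau>. \<tau> > 0 \<Longrightarrow> norm (m \<tau> - 1) \<le> M / (sqrt (norm \<kappa>) * \<tau>)"
    define \<rho> where "\<rho> = sqrt (norm \<kappa>)"
    define \<omega> where "\<omega> = \<kappa> / norm \<kappa>"
    define \<mu> where "\<mu> = l / \<rho>"
    have \<kappa>0: "\<kappa> \<noteq> 0" using \<kappa>(2) by auto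
    then have \<rho>0: "\<rho> > 0" by (simp add: \<rho>_def)
    have \<rho>2: "\<rho>\<^sup>2 = norm \<kappa>" by (simp add: \<rho>_def)
    have \<kappa>_eq: "\<kappa> = \<omega> * of_real \<rho> ^ 2" and l_eq: "l = \<mu> * \<rho>"
      using \<kappa>0 \<rho>0 by (simp_all add: \<omega>_def \<mu>_def \<rho>2 flip: of_real_power)
    have \<omega>: "norm \<omega> = 1" "Re \<omega> \<ge> c"
      using \<kappa>0 \<kappa> by (auto simp: \<omega>_def norm_divide Re_divide_of_real field_simps)
    have \<mu>: "norm \<mu> \<le> L"
      using l \<rho>0 by (simp add: \<mu>_def norm_divide field_simps \<rho>_def)
    define h where "h = (\<lambda>\<tau>::real. exp (\<kappa> * saddle_phase \<tau> + l * (of_real \<tau> - 1)) * m \<tau> / \<tau>)"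
    define g where "g = (\<lambda>\<tau>::real. indicator {0<..} \<tau> *\<^sub>R h \<tau>)"
    define G where "G = (\<lambda>y::real. exp (- \<omega> * of_real y ^ 2 + \<mu> * of_real y))"
    have G: "integrable lborel G"
      unfolding G_def using \<omega> assms by (intro integrable_complex_gaussian) auto
    have "continuous_on {0<..} h"
      unfolding h_def saddle_phase_def by (intro continuous_intros cont) auto
    then have gm [measurable]: "g \<in> borel_measurable borel"
      unfolding g_def by (intro borel_measurable_continuous_on_indicator) auto
    have bound: "norm (g (1 + 1 / \<rho> * y) - G y) \<le> (3 * M + 60) / \<rho> * W y" for y
    proof -
      have "g (1 + 1 / \<rho> * y) = (if 1 + y / \<rho> > 0 then exp (\<omega> * \<rho>\<^sup>2 * saddle_phase (1 + y / \<rho>) + \<mu> * y)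
          * m (1 + y / \<rho>) / (1 + y / \<rho>) else 0)"
        using \<rho>0 unfolding g_def h_def \<kappa>_eq l_eq by (simp add: indicator_def)
      then have "norm (g (1 + 1 / \<rho> * y) - G y) \<le>
          (3 * M + 6 * \<bar>y\<bar> + 2 * \<bar>y\<bar> ^ 3) / \<rho> * exp (L * \<bar>y\<bar> - c / 4 * y\<^sup>2)"
        using saddle_integrand_approx[of M \<rho> \<omega> c \<mu> L m y] assms \<rho>0 \<omega> \<mu> \<kappa> m
        unfolding G_def \<rho>2 by (simp add: \<rho>_def)
      \<comment> \<open>The polynomial is absorbed into exp |y|, which accounts for L + 1 in W.
        Since |y|^3 \<le> 27 exp |y|, the constant is 60 = 6 + 2 * 27.\<close>
      also have "\<dots> \<le> ((3 * M + 60) * exp \<bar>y\<bar>) / \<rho> * exp (L * \<bar>y\<bar> - c / 4 * y\<^sup>2)"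
      proof (intro mult_right_mono divide_right_mono)
        have "M * 1 \<le> M * exp \<bar>y\<bar>" using assms by (intro mult_left_mono) auto
        moreover have "\<bar>y\<bar> \<le> exp \<bar>y\<bar>" using exp_ge_add_one_self[of "\<bar>y\<bar>"] by linarith
        moreover have "\<bar>y\<bar> ^ 3 \<le> 27 * exp \<bar>y\<bar>"
        proof -
          have "(\<bar>y\<bar> / 3) ^ 3 \<le> (1 + \<bar>y\<bar> / real 3) ^ 3" by (intro power_mono) auto
          also have "\<dots> \<le> exp \<bar>y\<bar>" by (intro exp_ge_one_plus_x_over_n_power_n) auto
          finally show ?thesis by (simp add: power_divide)
        qed
        ultimately show "3 * M + 6 * \<bar>y\<bar> + 2 * \<bar>y\<bar> ^ 3 \<le> (3 * M + 60) * exp \<bar>y\<bar>"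
          by (simp add: algebra_simps)
      qed (use \<rho>0 in auto)
      also have "\<dots> = (3 * M + 60) / \<rho> * W y"
      proof -
        have "exp \<bar>y\<bar> * exp (L * \<bar>y\<bar> - c / 4 * y\<^sup>2) = W y"
          unfolding W_def by (simp flip: exp_add add: algebra_simps)
        then show ?thesis by (simp add: mult.assoc)
      qed
      finally show ?thesis .
    qed
    \<comment> \<open>The error bound also proves integrability: the rescaled integrand differs from
      an integrable Gaussian by a dominated function.\<close>
    have diff_int: "integrable lborel (\<lambda>y. g (1 + 1 / \<rho> * y) - G y)"
    proof (rule Bochner_Integration.integrable_bound)
      show "integrable lborel (\<lambda>y. (3 * M + 60) / \<rho> * W y)" using W by simp
      show "AE y in lborel. norm (g (1 + 1 / \<rho> * y) - G y) \<le> norm ((3 * M + 60) / \<rho> * W y)"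
      proof (rule AE_I2)
        fix y
        have "norm (g (1 + 1 / \<rho> * y) - G y) \<le> \<bar>(3 * M + 60) / \<rho> * W y\<bar>"
          using bound[of y] abs_ge_self order.trans by blast
        then show "norm (g (1 + 1 / \<rho> * y) - G y) \<le> norm ((3 * M + 60) / \<rho> * W y)"
          by (simp only: real_norm_def)
      qed
      have [measurable]: "G \<in> borel_measurable borel"
        using G[THEN borel_measurable_integrable] by simp
      show "(\<lambda>y. g (1 + 1 / \<rho> * y) - G y) \<in> borel_measurable lborel" by measurable
    qed
    from Bochner_Integration.integrable_add[OF this G]
    have int': "integrable lborel (\<lambda>y. g (1 + 1 / \<rho> * y))" by simp
    then have int: "integrable lborel g"
      using \<rho>0 by (subst (asm) lborel_integrable_real_affine_iff) auto
    have "(LINT \<tau>|lborel. g \<tau>) = (1 / \<rho>) *\<^sub>R (LINT y|lborel. g (1 + 1 / \<rho> * y))"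
      using lborel_integral_real_affine[of "1 / \<rho>" g 1] \<rho>0 by simp
    then have "of_real \<rho> * (LINT \<tau>|lborel. g \<tau>) - (LINT y|lborel. G y)
        = (LINT y|lborel. g (1 + 1 / \<rho> * y) - G y)"
      using \<rho>0 int' G by (simp add: scaleR_conv_of_real)
    also have "norm \<dots> \<le> (LINT y|lborel. (3 * M + 60) / \<rho> * W y)"
      using diff_int W bound by (intro Bochner_Integration.integral_norm_bound_integral) auto
    also have "\<dots> = C / \<rho>" by (simp add: C_def)
    also have "(LINT y|lborel. G y) = sqrt pi / csqrt (\<kappa> / norm \<kappa>) * exp (l\<^sup>2 / (4 * \<kappa>))"
    proof -
      have "\<mu>\<^sup>2 / (4 * \<omega>) = l\<^sup>2 / (4 * \<kappa>)"
        using \<rho>0 \<kappa>0 unfolding \<kappa>_eq l_eq by (simp add: power_mult_distrib)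
      then show ?thesis
        unfolding G_def using \<omega> assms by (subst integral_complex_gaussian) (auto simp: \<omega>_def)
    qed
    finally show "set_integrable lborel {0<..} (\<lambda>\<tau>. exp (\<kappa> * saddle_phase \<tau> + l * (of_real \<tau> - 1)) * m \<tau> / \<tau>) \<and>
        norm (sqrt (norm \<kappa>) * (LINT \<tau>:{0<..}|lborel. exp (\<kappa> * saddle_phase \<tau> + l * (of_real \<tau> - 1)) * m \<tau> / \<tau>)
          - sqrt pi / csqrt (\<kappa> / norm \<kappa>) * exp (l\<^sup>2 / (4 * \<kappa>))) \<le> C / sqrt (norm \<kappa>)"
      using int unfolding set_integrable_def set_lebesgue_integral_def h_def g_def \<rho>_def by blast
  qed
qed

section \<open>The Gamma function as a saddle point integral\<close>

text \<open>Crude in the argument, which is only bounded by pi; enough for moving contours, where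
  the exponent is fixed and only the growth in x matters.\<close>

lemma norm_powr_le:
  fixes x y :: complex
  shows "norm (x powr y) \<le> norm x powr Re y * exp (pi * \<bar>Im y\<bar>)"
proof -
  have "- Im y * Arg x \<le> \<bar>Im y\<bar> * pi"
  proof -
    have "- Im y * Arg x \<le> \<bar>- Im y * Arg x\<bar>" by simp
    also have "\<dots> \<le> \<bar>Im y\<bar> * pi"
      unfolding abs_mult using Arg_bounded[of x] by (intro mult_mono) auto
    finally show ?thesis .
  qed
  then show ?thesis
    unfolding norm_powr_complex by (intro mult_left_mono) (auto simp: mult.commute)
qed

lemma closed_segment_Re_ge:
  assumes "x \<in> closed_segment p q" "Re p \<ge> a" "Re q \<ge> a"
  shows "Re x \<ge> a"
  using closed_segment_subset[OF _ _ convex_halfspace_Re_ge[of a], of p q] assms by auto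

lemma closed_segment_norm_le:
  fixes x :: "'a :: real_normed_vector"
  assumes "x \<in> closed_segment p q" "norm p \<le> K" "norm q \<le> K"
  shows "norm x \<le> K"
  using closed_segment_subset[OF _ _ convex_cball[of 0 K], of p q] assms by auto

text \<open>Put t = z \<tau>^2 in Euler's integral. The square produces \<open>saddle_phase\<close>,
  as 2 z ln \<tau> - z \<tau>^2 + z = 2 z (ln \<tau> - (\<tau>^2 - 1) / 2), and dt / t = 2 d\<tau> /
  \<tau> gives the factor 2. The ray of z and the positive axis both lie in the right half-plane,
  where the integrand has a primitive. \<open>Re z \<ge> 1\<close> keeps t^(z - 1) bounded near
  0.\<close>

lemma Gamma_eq_saddle_integral:
  assumes z: "Re z \<ge> 1"
    and int: "set_integrable lborel {0<..} (\<lambda>\<tau>::real. exp (2 * z * saddle_phase \<tau>) / \<tau>)"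
  shows "Gamma z = 2 * exp (z * Ln z - z) * (LINT \<tau>:{0<..}|lborel. exp (2 * z * saddle_phase \<tau>) / of_real \<tau>)"
proof -
  define S where "S = {w. Re w > 0}"
  define f where "f = (\<lambda>t::complex. t powr (z - 1) * exp (- t))"
  have S_nonpos: "w \<notin> \<real>\<^sub>\<le>\<^sub>0" if "w \<in> S" for w
    using that by (auto simp: S_def complex_nonpos_Reals_iff)
  have hol: "f holomorphic_on S"
    unfolding f_def by (intro holomorphic_intros) (use S_nonpos in auto)
  have "convex S" "open S"
    unfolding S_def by (simp_all add: convex_halfspace_Re_gt open_halfspace_Re_gt)
  then obtain F where F: "\<And>x. x \<in> S \<Longrightarrow> (F has_field_derivative f x) (at x)"
    using holomorphic_convex_primitive'[OF _ _ hol] by (metis at_within_open)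
  note contf = holomorphic_on_imp_continuous_on[OF hol]
  have z0: "z \<noteq> 0" using z by auto
  have zS: "z * of_real r \<in> S" if "r > 0" for r using that z by (simp add: S_def)

  have f_real: "f (of_real t) = of_real t powr (z - 1) / of_real (exp t)" for t
    by (simp add: f_def exp_minus field_simps exp_of_real)
  have cont1: "continuous_on {0<..} (\<lambda>t::real. f (of_real t))"
    by (rule continuous_on_compose2[OF contf]) (auto simp: S_def intro!: continuous_intros)
  have int1: "set_integrable lborel {0<..} (\<lambda>t::real. f (of_real t))"
  proof -
    have "integrable lebesgue (\<lambda>t. indicator {0<..} t *\<^sub>R f (of_real t))"
      using absolutely_integrable_Gamma_integral'[of z] z
      unfolding f_real[symmetric] set_integrable_def by simp
    then show ?thesis
      unfolding set_integrable_def
      by (subst (asm) integrable_completion)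
        (use borel_measurable_continuous_on_indicator[OF _ cont1] in auto)
  qed
  have I1: "(LINT t:{0<..}|lborel. f (of_real t)) = Gamma z"
    using set_borel_integral_eq_integral(2)[OF int1] Gamma_integral_complex'[of z] z
    by (auto simp: f_real intro: integral_unique)
  have lim1: "(\<lambda>n. F (of_real (real (Suc n))) - F (of_real (1 / real (Suc n)))) \<longlonglongrightarrow> Gamma z"
    unfolding I1[symmetric]
  proof (rule LIMSEQ_FTC_Ioi[OF int1 _ cont1])
    fix t :: real assume "t > 0"
    then show "((\<lambda>t. F (of_real t)) has_vector_derivative f (of_real t)) (at t)"
      by (intro has_vector_derivative_real_field F) (simp add: S_def)
  qed

  define g where "g = (\<lambda>\<tau>::real. f (z * of_real \<tau> ^ 2) * (2 * z * of_real \<tau>))"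
  have g_eq: "g \<tau> = 2 * exp (z * Ln z - z) * (exp (2 * z * saddle_phase \<tau>) / of_real \<tau>)" if "\<tau> > 0" for \<tau>
  proof -
    have Lnz: "Ln (z * of_real \<tau> ^ 2) = Ln z + 2 * of_real (ln \<tau>)"
      using that z0 Ln_times_of_real[of "\<tau>\<^sup>2" z] Ln_of_real[of "\<tau>\<^sup>2"]
      by (simp add: ln_realpow mult.commute)
    have "f (z * of_real \<tau> ^ 2) = exp ((z - 1) * (Ln z + 2 * of_real (ln \<tau>)) + - (z * of_real \<tau> ^ 2))"
      using that z0 by (simp only: f_def powr_def Lnz exp_add) simp
    also have "(z - 1) * (Ln z + 2 * of_real (ln \<tau>)) + - (z * of_real \<tau> ^ 2) =
        (z * Ln z - z) + 2 * z * of_real (saddle_phase \<tau>) + - (Ln z + of_real (ln \<tau>) + of_real (ln \<tau>))"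
      by (simp add: saddle_phase_def field_simps)
    also have "exp \<dots> = exp (z * Ln z - z) * exp (2 * z * of_real (saddle_phase \<tau>)) / (z * of_real \<tau> * of_real \<tau>)"
      using that z0 by (simp only: exp_add exp_minus exp_Ln exp_of_real exp_ln) (simp add: field_simps)
    finally show ?thesis using that z0 by (simp add: g_def field_simps)
  qed
  have I2: "(LINT \<tau>:{0<..}|lborel. g \<tau>) =
      2 * exp (z * Ln z - z) * (LINT \<tau>:{0<..}|lborel. exp (2 * z * saddle_phase \<tau>) / of_real \<tau>)"
    by (subst set_integral_mult_right[symmetric]) (auto intro!: set_lebesgue_integral_cong simp: g_eq)
  have int2: "set_integrable lborel {0<..} g"
    using set_integrable_mult_right[of "2 * exp (z * Ln z - z)", OF int]
    by (subst set_integrable_cong) (auto simp: g_eq)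
  have lim2: "(\<lambda>n. F (z * of_real (real (Suc n)) ^ 2) - F (z * of_real (1 / real (Suc n)) ^ 2))
     \<longlonglongrightarrow> (LINT \<tau>:{0<..}|lborel. g \<tau>)"
  proof (rule LIMSEQ_FTC_Ioi[OF int2])
    fix \<tau> :: real assume \<tau>: "\<tau> > 0"
    have "((\<lambda>w. F (z * w\<^sup>2)) has_field_derivative f (z * of_real \<tau> ^ 2) * (2 * z * of_real \<tau>)) (at (of_real \<tau>))"
      by (rule DERIV_chain2[OF F]) (use \<tau> zS[of "\<tau>\<^sup>2"] in \<open>auto intro!: derivative_eq_intros\<close>)
    then show "((\<lambda>\<tau>. F (z * of_real \<tau> ^ 2)) has_vector_derivative g \<tau>) (at \<tau>)"
      unfolding g_def by (rule has_vector_derivative_real_field)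
  next
    have "continuous_on {0<..} (\<lambda>\<tau>::real. f (z * of_real \<tau> ^ 2))"
      by (rule continuous_on_compose2[OF contf])
        (use zS[of "_\<^sup>2"] in \<open>auto intro!: continuous_intros\<close>)
    then show "continuous_on {0<..} g" unfolding g_def by (intro continuous_intros)
  qed

  define K where "K = norm z + 1"
  have K: "norm z \<le> K" "1 \<le> K" by (auto simp: K_def)
  have fb: "norm (f x) \<le> M powr (Re z - 1) * exp (pi * \<bar>Im z\<bar>) * exp (- Re x)" if "norm x \<le> M" for x M
  proof -
    have "norm (f x) \<le> (norm x powr Re (z - 1) * exp (pi * \<bar>Im (z - 1)\<bar>)) * exp (- Re x)"
      unfolding f_def norm_mult norm_exp_eq_Re
      by (intro mult_mono norm_powr_le) auto
    also have "\<dots> \<le> (M powr (Re z - 1) * exp (pi * \<bar>Im z\<bar>)) * exp (- Re x)"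
      using powr_mono2[of "Re z - 1" "norm x" M] that z by (simp add: mult_right_mono)
    finally show ?thesis .
  qed
  have far: "(\<lambda>n. F (z * of_real (real (Suc n)) ^ 2) - F (of_real (real (Suc n)))) \<longlonglongrightarrow> 0"
  proof (rule primitive_diff_tendsto_0[of S F f, OF F])
    let ?B = "\<lambda>n. (K * real (Suc n) ^ 2) powr (Re z - 1) * exp (pi * \<bar>Im z\<bar>) * exp (- real (Suc n))"
    show "\<forall>\<^sub>F n in sequentially. \<forall>x\<in>closed_segment (z * of_real (real (Suc n)) ^ 2) (of_real (real (Suc n))).
        x \<in> S \<and> norm (f x) \<le> ?B n"
    proof (intro always_eventually allI ballI)
      fix n x assume x: "x \<in> closed_segment (z * of_real (real (Suc n)) ^ 2) (of_real (real (Suc n)))"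
      define N where "N = real (Suc n)"
      have N: "N \<ge> 1" by (simp add: N_def)
      have N2: "N \<le> N\<^sup>2" using N by (simp add: power2_eq_square)
      \<comment> \<open>Both ends have real part at least N, so exp (- x) decays along the whole
        segment and beats the powers of N.\<close>
      have Re: "Re x \<ge> N"
      proof (rule closed_segment_Re_ge[OF x[folded N_def]])
        have "N \<le> 1 * N\<^sup>2" using N2 by simp
        also have "\<dots> \<le> Re z * N\<^sup>2" using z by (intro mult_right_mono) auto
        finally show "N \<le> Re (z * of_real N ^ 2)" by (simp flip: of_real_power)
      qed simp
      have "norm x \<le> K * N\<^sup>2"
      proof (rule closed_segment_norm_le[OF x[folded N_def]])
        show "norm (z * of_real N ^ 2) \<le> K * N\<^sup>2"
          using K by (simp add: norm_mult norm_power mult_right_mono)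
        have "1 * N \<le> K * N\<^sup>2" using K N N2 by (intro mult_mono) auto
        then show "norm (of_real N :: complex) \<le> K * N\<^sup>2" using N by simp
      qed
      from fb[OF this] have "norm (f x) \<le> (K * N\<^sup>2) powr (Re z - 1) * exp (pi * \<bar>Im z\<bar>) * exp (- Re x)" .
      also have "\<dots> \<le> (K * N\<^sup>2) powr (Re z - 1) * exp (pi * \<bar>Im z\<bar>) * exp (- N)"
        using Re by (intro mult_left_mono) auto
      finally show "x \<in> S \<and> norm (f x) \<le> ?B n"
        using Re N unfolding S_def N_def by auto
    qed
    show "(\<lambda>n. ?B n * norm (z * of_real (real (Suc n)) ^ 2 - of_real (real (Suc n)))) \<longlonglongrightarrow> 0"
    proof (rule Lim_null_comparison)
      have "K > 0" using K by simp
      then show "(\<lambda>n. ?B n * (2 * K * real (Suc n) ^ 2)) \<longlonglongrightarrow> 0"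
        by real_asymp
      have "norm (z * of_real (real (Suc n)) ^ 2 - of_real (real (Suc n))) \<le> 2 * K * real (Suc n) ^ 2" for n
      proof -
        have "norm (z * of_real (real (Suc n)) ^ 2 - of_real (real (Suc n)))
           \<le> norm (z * of_real (real (Suc n)) ^ 2) + norm (of_real (real (Suc n)) :: complex)"
          by (rule norm_triangle_ineq4)
        also have "\<dots> = norm z * real (Suc n) ^ 2 + 1 * real (Suc n)"
          by (simp only: norm_mult norm_power norm_of_real) simp
        also have "\<dots> \<le> K * real (Suc n) ^ 2 + K * real (Suc n) ^ 2"
          using K by (intro add_mono mult_mono self_le_power) auto
        finally show ?thesis by simp
      qed
      then show "\<forall>\<^sub>F n in sequentially. norm (?B n * norm (z * of_real (real (Suc n)) ^ 2 - of_real (real (Suc n))))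
          \<le> ?B n * (2 * K * real (Suc n) ^ 2)"
        unfolding norm_mult by (intro always_eventually allI mult_mono) auto
    qed
  qed
  have near: "(\<lambda>n. F (z * of_real (1 / real (Suc n)) ^ 2) - F (of_real (1 / real (Suc n)))) \<longlonglongrightarrow> 0"
  proof (rule primitive_diff_tendsto_0[of S F f, OF F])
    let ?B = "K powr (Re z - 1) * exp (pi * \<bar>Im z\<bar>)"
    have small: "norm (z * of_real (1 / real (Suc n)) ^ 2) \<le> K / real (Suc n)"
      "norm (of_real (1 / real (Suc n)) :: complex) \<le> K / real (Suc n)" for n
    proof -
      define N where "N = real (Suc n)"
      have N: "N \<ge> 1" by (simp add: N_def)
      have "norm z * (1 / N)\<^sup>2 \<le> K * (1 / N)"
        using K N by (intro mult_mono) (auto simp: power2_eq_square field_simps)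
      then show "norm (z * of_real (1 / real (Suc n)) ^ 2) \<le> K / real (Suc n)"
        using N unfolding N_def[symmetric] by (simp add: norm_mult norm_power norm_divide)
      show "norm (of_real (1 / real (Suc n)) :: complex) \<le> K / real (Suc n)"
        using N K unfolding N_def[symmetric] norm_of_real by (simp add: divide_right_mono)
    qed
    have KN: "K / real (Suc n) \<le> K" for n using K by (simp add: field_simps)
    show "\<forall>\<^sub>F n in sequentially. \<forall>x\<in>closed_segment (z * of_real (1 / real (Suc n)) ^ 2) (of_real (1 / real (Suc n))).
        x \<in> S \<and> norm (f x) \<le> ?B"
    proof (intro always_eventually allI ballI)
      fix n x assume x: "x \<in> closed_segment (z * of_real (1 / real (Suc n)) ^ 2) (of_real (1 / real (Suc n)))"
      have xS: "x \<in> S"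
        using closed_segment_subset[OF _ _ \<open>convex S\<close>, of "z * of_real (1 / real (Suc n)) ^ 2" "of_real (1 / real (Suc n))"]
          zS[of "(1 / real (Suc n))\<^sup>2"] x unfolding S_def by auto
      have "norm x \<le> K"
        using closed_segment_norm_le[OF x] small[of n] KN[of n] by (meson order.trans)
      from fb[OF this] have "norm (f x) \<le> ?B * exp (- Re x)" .
      also have "\<dots> \<le> ?B * 1" using xS by (intro mult_left_mono) (auto simp: S_def)
      finally show "x \<in> S \<and> norm (f x) \<le> ?B" using xS by simp
    qed
    show "(\<lambda>n. ?B * norm (z * of_real (1 / real (Suc n)) ^ 2 - of_real (1 / real (Suc n)))) \<longlonglongrightarrow> 0"
    proof (rule Lim_null_comparison)
      show "(\<lambda>n. ?B * (2 * K / real (Suc n))) \<longlonglongrightarrow> 0"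
        by real_asymp
      have "norm (z * of_real (1 / real (Suc n)) ^ 2 - of_real (1 / real (Suc n))) \<le> 2 * K / real (Suc n)" for n
        using norm_triangle_ineq4[of "z * of_real (1 / real (Suc n)) ^ 2" "of_real (1 / real (Suc n))"]
          add_mono[OF small[of n]] by simp
      then show "\<forall>\<^sub>F n in sequentially. norm (?B * norm (z * of_real (1 / real (Suc n)) ^ 2 - of_real (1 / real (Suc n))))
          \<le> ?B * (2 * K / real (Suc n))"
        unfolding norm_mult by (intro always_eventually allI mult_mono) auto
    qed
  qed
  have "(\<lambda>n. (F (z * of_real (real (Suc n)) ^ 2) - F (z * of_real (1 / real (Suc n)) ^ 2))
      - (F (of_real (real (Suc n))) - F (of_real (1 / real (Suc n))))) \<longlonglongrightarrow> 0"
    using tendsto_diff[OF far near] by (simp add: algebra_simps)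
  from LIMSEQ_unique[OF this tendsto_diff[OF lim2 lim1]] show ?thesis
    unfolding I2 by simp
qed

section \<open>Rotation of the line of integration\<close>

text \<open>The plane slit along the real axis up to 0 and from 1 onwards. The slits contain the
  branch cut and every integer, hence every pole of the integrand; the gap between them is where the
  line of integration crosses.\<close>

definition cut_plane :: "complex set" where
  "cut_plane = {x. Im x \<noteq> 0 \<or> (0 < Re x \<and> Re x < 1)}"

lemma open_cut_plane: "open cut_plane"
proof -
  have "cut_plane = {x. Im x < 0} \<union> {x. Im x > 0} \<union> ({x. Re x > 0} \<inter> {x. Re x < 1})"
    by (auto simp: cut_plane_def)
  also have "open \<dots>"
    by (intro open_Un open_Int open_halfspace_Im_lt open_halfspace_Im_gt
        open_halfspace_Re_lt open_halfspace_Re_gt)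
  finally show ?thesis .
qed

text \<open>Both parts of the line and both rays lie in one simply connected domain, star-shaped about 1/2,
  so a single primitive of the integrand serves for all of them.\<close>

lemma starlike_cut_plane: "starlike cut_plane"
  unfolding starlike_def
proof (intro bexI ballI subsetI)
  show half: "(1 / 2 :: complex) \<in> cut_plane" by (simp add: cut_plane_def)
  fix x y assume x: "x \<in> cut_plane" and "y \<in> closed_segment (1 / 2) x"
  then obtain u where u: "0 \<le> u" "u \<le> 1" and y: "y = (1 - u) *\<^sub>R (1 / 2) + u *\<^sub>R x"
    by (auto simp: closed_segment_def)
  show "y \<in> cut_plane"
  proof (cases "u = 0 \<or> Im x \<noteq> 0")
    case True
    then show ?thesis using half by (auto simp: y cut_plane_def)
  next
    case False
    then have "0 < u * Re x" "u * Re x < u * 1" using x u by (auto simp: cut_plane_def)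
    then show ?thesis using u by (auto simp: y cut_plane_def field_simps)
  qed
qed

lemma R_integrand_sin:
  fixes x :: complex
  shows "R_integrand s x = x powr (- s) * exp (pi * \<i> * x\<^sup>2) / (2 * \<i> * sin (pi * x))"
proof -
  have "2 * \<i> * sin (pi * x) = exp (pi * \<i> * x) - exp (- (pi * \<i> * x))"
    by (simp add: sin_exp_eq mult_ac)
  then show ?thesis by (simp only: R_integrand_def)
qed

section \<open>Bounds for the denominator and the integrand\<close>

lemma square_le_sinh_square: "u\<^sup>2 \<le> (exp u - inverse (exp u))\<^sup>2 / 4" for u :: real
proof -
  have "\<bar>u\<bar> \<le> \<bar>exp u - inverse (exp u)\<bar> / 2"
    using real_le_x_sinh[of u] real_le_x_sinh[of "-u"] by (cases "u \<ge> 0") (simp_all add: exp_minus)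
  then have "\<bar>u\<bar>\<^sup>2 \<le> (\<bar>exp u - inverse (exp u)\<bar> / 2)\<^sup>2" by (intro power_mono) auto
  then show ?thesis by (simp add: power_divide)
qed

lemma norm_sin_ge_Im: "\<bar>Im z\<bar> \<le> norm (sin z)"
proof -
  have "norm (sin z) ^ 2 = cos (Re (z - pi / 2)) ^ 2 + (exp (Im (z - pi / 2)) - inverse (exp (Im (z - pi / 2)))) ^ 2 / 4"
    by (subst norm_cos_squared[symmetric]) (simp add: cos_diff flip: cos_of_real sin_of_real)
  then have "\<bar>Im z\<bar>\<^sup>2 \<le> norm (sin z) ^ 2"
    using square_le_sinh_square[of "Im z"] by (simp add: add_increasing)
  then show ?thesis by (rule power2_le_imp_le) simp
qed

text \<open>With u = pi b the squared modulus is cos^2 u + sinh^2 u, and |sinh u| \<ge> |u| \<ge>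
  |sin u|. The line of integration has this form, so its denominator stays away from 0 even at the
  crossing with the real axis.\<close>

lemma norm_sin_diagonal_ge_1:
  fixes b :: real
  shows "1 \<le> norm (sin (pi * (1 / 2 + of_real b * (1 + \<i>))))"
proof -
  let ?u = "pi * b"
  have "sin (pi * (1 / 2 + of_real b * (1 + \<i>))) = cos (of_real ?u * (1 + \<i>))"
    by (simp add: distrib_left sin_add mult_ac flip: cos_of_real sin_of_real)
  then have "norm (sin (pi * (1 / 2 + of_real b * (1 + \<i>)))) ^ 2
      = cos ?u ^ 2 + (exp ?u - inverse (exp ?u)) ^ 2 / 4"
    by (simp only: norm_cos_squared) simp
  moreover have "(sin ?u)\<^sup>2 \<le> ?u\<^sup>2"
    using abs_sin_x_le_abs_x[of ?u] by (simp only: abs_le_square_iff)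
  moreover have "?u\<^sup>2 \<le> (exp ?u - inverse (exp ?u)) ^ 2 / 4"
    by (rule square_le_sinh_square)
  ultimately have "1\<^sup>2 \<le> norm (sin (pi * (1 / 2 + of_real b * (1 + \<i>)))) ^ 2"
    using sin_cos_squared_add[of ?u] unfolding one_power2 by linarith
  then show ?thesis by (rule power2_le_imp_le) simp
qed

lemma cut_plane_not_nonpos_Reals: "x \<in> cut_plane \<Longrightarrow> x \<notin> \<real>\<^sub>\<le>\<^sub>0"
  by (auto simp: cut_plane_def complex_nonpos_Reals_iff)

lemma sin_pi_nonzero_cut_plane:
  fixes x :: complex
  assumes "x \<in> cut_plane"
  shows "sin (pi * x) \<noteq> 0"
proof (cases "Im x = 0")
  case True
  then have x: "x = of_real (Re x)" and "0 < Re x" "Re x < 1"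
    using assms by (auto simp: cut_plane_def complex_eq_iff)
  then have "sin (pi * Re x) > 0" by (intro sin_gt_zero) auto
  moreover have "sin (pi * x) = of_real (sin (pi * Re x))"
    by (subst x) (simp flip: sin_of_real)
  ultimately show ?thesis by simp
next
  case False
  then have "0 < \<bar>Im (pi * x)\<bar>" by simp
  also have "\<dots> \<le> norm (sin (pi * x))" by (rule norm_sin_ge_Im)
  finally show ?thesis by auto
qed

lemma holomorphic_R_integrand: "R_integrand s holomorphic_on cut_plane"
proof -
  have "(\<lambda>x. x powr (- s) * exp (pi * \<i> * x\<^sup>2) / (2 * \<i> * sin (pi * x))) holomorphic_on cut_plane"
    by (intro holomorphic_intros) (use cut_plane_not_nonpos_Reals sin_pi_nonzero_cut_plane in auto)
  then show ?thesis by (simp add: R_integrand_sin[abs_def])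
qed

lemma norm_R_integrand_le:
  fixes x :: complex
  shows "norm (R_integrand s x) \<le>
    norm x powr (- Re s) * exp (pi * \<bar>Im s\<bar>) * exp (- 2 * pi * Re x * Im x) / (2 * norm (sin (pi * x)))"
proof -
  have "norm (R_integrand s x) = norm (x powr (- s)) * exp (- 2 * pi * Re x * Im x) / (2 * norm (sin (pi * x)))"
    unfolding R_integrand_sin norm_mult norm_divide norm_exp_eq_Re by (simp add: power2_eq_square algebra_simps)
  also have "\<dots> \<le> norm x powr (- Re s) * exp (pi * \<bar>Im s\<bar>) * exp (- 2 * pi * Re x * Im x) / (2 * norm (sin (pi * x)))"
    using norm_powr_le[of x "- s"] by (intro divide_right_mono mult_right_mono) auto
  finally show ?thesis .
qed

text \<open>Near 0 the modulus of sin (pi x) exceeds that of x, because the derivative there is pi >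
  1, while |x|^(- Re s) \<le> |x|. The simple zero of the denominator is thus compensated.\<close>

lemma R_integrand_bounded_near_0:
  assumes "Re s \<le> - 1"
  obtains B \<delta> where "\<delta> > 0" "\<And>x. 0 < norm x \<Longrightarrow> norm x < \<delta> \<Longrightarrow> norm (R_integrand s x) \<le> B"
proof -
  have "((\<lambda>x::complex. sin (pi * x)) has_field_derivative pi) (at 0)"
    by (auto intro!: derivative_eq_intros)
  then have "((\<lambda>x::complex. sin (pi * x) / x) \<longlongrightarrow> pi) (at 0)"
    by (simp add: DERIV_def)
  then have "((\<lambda>x::complex. norm (sin (pi * x) / x)) \<longlongrightarrow> norm (of_real pi :: complex)) (at 0)"
    by (rule tendsto_norm)
  moreover have "1 < norm (of_real pi :: complex)" using pi_gt3 by simp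
  ultimately have "\<forall>\<^sub>F x in at (0::complex). 1 < norm (sin (pi * x) / x)"
    by (rule order_tendstoD)
  then obtain d where d: "d > 0" "\<And>x::complex. x \<noteq> 0 \<Longrightarrow> norm x < d \<Longrightarrow> 1 < norm (sin (pi * x) / x)"
    unfolding eventually_at by (auto simp: dist_norm)
  show thesis
  proof (rule that[of "min d 1" "exp (pi * \<bar>Im s\<bar>) * exp (2 * pi)"])
    fix x :: complex assume x: "0 < norm x" "norm x < min d 1"
    then have sin_ge: "norm x \<le> norm (sin (pi * x))"
      using d(2)[of x] by (auto simp: norm_divide field_simps)
    then have sin_ge2: "norm x \<le> 2 * norm (sin (pi * x))" using norm_ge_zero[of x] by linarith
    have "\<bar>Re x * Im x\<bar> \<le> 1 * 1"
      unfolding abs_mult using x abs_Re_le_cmod[of x] abs_Im_le_cmod[of x] by (intro mult_mono) auto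
    then have "- (Re x * Im x) \<le> 1" by linarith
    then have "2 * pi * (- (Re x * Im x)) \<le> 2 * pi * 1" by (intro mult_left_mono) auto
    then have e: "exp (- 2 * pi * Re x * Im x) \<le> exp (2 * pi)" by (simp add: mult_ac)
    have p: "norm x powr (- Re s) \<le> norm x"
      using powr_mono'[of 1 "- Re s" "norm x"] x assms by simp
    have "norm (R_integrand s x) \<le>
      norm x powr (- Re s) * exp (pi * \<bar>Im s\<bar>) * exp (- 2 * pi * Re x * Im x) / (2 * norm (sin (pi * x)))"
      by (rule norm_R_integrand_le)
    also have "\<dots> \<le> norm x * exp (pi * \<bar>Im s\<bar>) * exp (2 * pi) / norm x"
      using p e sin_ge2 x by (intro frac_le mult_mono) auto
    also have "\<dots> = exp (pi * \<bar>Im s\<bar>) * exp (2 * pi)" using x by simp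
    finally show "norm (R_integrand s x) \<le> exp (pi * \<bar>Im s\<bar>) * exp (2 * pi)" .
  qed (use d in auto)
qed

text \<open>The Gaussian factor has modulus exp (- 2 pi Re x Im x), so decay requires a lower bound
  k for that product, that is, staying inside the first or third quadrant.\<close>

lemma norm_R_integrand_far_le:
  fixes x :: complex
  assumes "Re s \<le> 0" "norm x \<le> M" "\<bar>Im x\<bar> \<ge> 1" "k \<le> Re x * Im x"
  shows "norm (R_integrand s x) \<le> M powr (- Re s) * exp (pi * \<bar>Im s\<bar>) * exp (- 2 * pi * k)"
proof -
  have "1 \<le> \<bar>Im (pi * x)\<bar>" using assms(3) pi_gt3 mult_mono[of 1 pi 1 "\<bar>Im x\<bar>"] by (simp add: abs_mult)
  also have "\<dots> \<le> norm (sin (pi * x))" by (rule norm_sin_ge_Im)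
  finally have sin_ge: "1 \<le> 2 * norm (sin (pi * x))" by simp
  have e: "exp (- 2 * pi * Re x * Im x) \<le> exp (- 2 * pi * k)"
    using assms(4) by (simp add: mult.assoc)
  have p: "norm x powr (- Re s) \<le> M powr (- Re s)"
    using assms by (intro powr_mono2) auto
  have "norm (R_integrand s x) \<le>
      norm x powr (- Re s) * exp (pi * \<bar>Im s\<bar>) * exp (- 2 * pi * Re x * Im x) / (2 * norm (sin (pi * x)))"
    by (rule norm_R_integrand_le)
  also have "\<dots> \<le> M powr (- Re s) * exp (pi * \<bar>Im s\<bar>) * exp (- 2 * pi * k) / 1"
    using p e sin_ge by (intro frac_le mult_mono) auto
  finally show ?thesis by simp
qed

section \<open>The line of integration and its deformation\<close>

lemma swdir_eq: "swdir = - of_real (1 / sqrt 2) * (1 + \<i>)"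
proof -
  have "cos (3 * pi / 4) = - (1 / sqrt 2)" "sin (3 * pi / 4) = 1 / sqrt 2"
  proof -
    have "3 * pi / 4 = pi - pi / 4" "1 / sqrt 2 = sqrt 2 / 2"
      by (simp_all add: real_div_sqrt field_simps)
    show "cos (3 * pi / 4) = - (1 / sqrt 2)" "sin (3 * pi / 4) = 1 / sqrt 2"
      by (simp_all only: \<open>3 * pi / 4 = pi - pi / 4\<close> cos_pi_minus sin_pi_minus cos_45 sin_45 \<open>1 / sqrt 2 = sqrt 2 / 2\<close>)
  qed
  then show ?thesis
    by (simp add: swdir_def complex_eq_iff)
qed

definition R_line :: "real \<Rightarrow> complex" where
  "R_line r = 1 / 2 + of_real r * swdir"

lemma R_line_eq: "R_line r = 1 / 2 + of_real (- r / sqrt 2) * (1 + \<i>)"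
  by (simp add: R_line_def swdir_eq)

lemma Re_R_line: "Re (R_line r) = 1 / 2 - r / sqrt 2"
  and Im_R_line: "Im (R_line r) = - r / sqrt 2"
  by (simp_all add: R_line_eq)

lemma norm_swdir: "norm swdir = 1"
  by (simp add: swdir_def)

lemma norm_R_line_le: "norm (R_line r) \<le> 1 / 2 + \<bar>r\<bar>"
proof -
  have "norm (R_line r) \<le> norm (1 / 2 :: complex) + norm (of_real r * swdir)"
    unfolding R_line_def by (rule norm_triangle_ineq)
  then show ?thesis by (simp add: norm_mult norm_swdir)
qed

lemma R_line_in_cut_plane: "R_line r \<in> cut_plane"
  by (cases "r = 0") (auto simp: cut_plane_def Re_R_line Im_R_line)

lemma continuous_on_R_line: "continuous_on A R_line"
  unfolding R_line_def by (intro continuous_intros)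

lemma integrable_R_line:
  assumes "Re s \<le> 0"
  shows "integrable lborel (\<lambda>r. R_integrand s (R_line r) * swdir)"
proof (rule Bochner_Integration.integrable_bound)
  let ?W = "\<lambda>r. exp (pi * \<bar>Im s\<bar>) * exp ((pi - Re s) * \<bar>r\<bar> - pi * r\<^sup>2)"
  show "integrable lborel ?W"
    by (intro integrable_mult_right integrable_gaussian_tilt) auto
  show "AE r in lborel. norm (R_integrand s (R_line r) * swdir) \<le> norm (?W r)"
  proof (rule AE_I2)
    fix r :: real
    have "1 \<le> norm (sin (pi * R_line r))"
      unfolding R_line_eq by (rule norm_sin_diagonal_ge_1)
    then have sin_ge: "1 \<le> 2 * norm (sin (pi * R_line r))" by simp
    have "norm (R_line r) \<le> exp \<bar>r\<bar>"
      using norm_R_line_le[of r] exp_ge_add_one_self[of "\<bar>r\<bar>"] by linarith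
    then have "norm (R_line r) powr (- Re s) \<le> exp \<bar>r\<bar> powr (- Re s)"
      using assms by (intro powr_mono2) auto
    then have p: "norm (R_line r) powr (- Re s) \<le> exp (- Re s * \<bar>r\<bar>)"
      by (simp add: powr_def)
    have "- 2 * pi * Re (R_line r) * Im (R_line r) = pi * (r / sqrt 2) - pi * r\<^sup>2"
      by (simp add: Re_R_line Im_R_line field_simps power2_eq_square)
    also have "\<dots> \<le> pi * \<bar>r\<bar> - pi * r\<^sup>2"
    proof -
      have "r / sqrt 2 \<le> \<bar>r\<bar> / 1" by (intro frac_le) auto
      then have "pi * (r / sqrt 2) \<le> pi * \<bar>r\<bar>" by (intro mult_left_mono) auto
      then show ?thesis by simp
    qed
    finally have e: "exp (- 2 * pi * Re (R_line r) * Im (R_line r)) \<le> exp (pi * \<bar>r\<bar> - pi * r\<^sup>2)" by simp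
    have "norm (R_integrand s (R_line r) * swdir) = norm (R_integrand s (R_line r))"
      by (simp add: norm_mult norm_swdir)
    also have "\<dots> \<le> norm (R_line r) powr (- Re s) * exp (pi * \<bar>Im s\<bar>)
        * exp (- 2 * pi * Re (R_line r) * Im (R_line r)) / (2 * norm (sin (pi * R_line r)))"
      by (rule norm_R_integrand_le)
    also have "\<dots> \<le> exp (- Re s * \<bar>r\<bar>) * exp (pi * \<bar>Im s\<bar>) * exp (pi * \<bar>r\<bar> - pi * r\<^sup>2) / 1"
      using p e sin_ge by (intro frac_le mult_mono) auto
    also have "\<dots> = ?W r" by (simp flip: exp_add add: algebra_simps)
    finally show "norm (R_integrand s (R_line r) * swdir) \<le> norm (?W r)" by simp
  qed
  have "continuous_on UNIV (\<lambda>r. R_integrand s (R_line r) * swdir)"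
    by (intro continuous_intros continuous_on_compose2[OF
          holomorphic_on_imp_continuous_on[OF holomorphic_R_integrand] continuous_on_R_line])
      (auto simp: R_line_in_cut_plane)
  then show "(\<lambda>r. R_integrand s (R_line r) * swdir) \<in> borel_measurable lborel"
    using borel_measurable_continuous_onI by simp
qed

text \<open>Passing from x in the upper half-plane to -x lowers the principal logarithm by pi i, and
  the sine is odd.\<close>

lemma R_integrand_uminus:
  fixes x :: complex
  assumes "Im x > 0"
  shows "R_integrand s (- x) = - exp (\<i> * pi * s) * R_integrand s x"
proof -
  have "x \<noteq> 0" using assms by auto
  then have "Ln (- x) = Ln x - \<i> * pi" using assms by (subst Ln_minus) auto
  then have "(- x) powr (- s) = exp (\<i> * pi * s) * x powr (- s)"
    using \<open>x \<noteq> 0\<close> by (simp add: powr_def exp_add[symmetric] right_diff_distrib mult_ac)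
  then show ?thesis by (simp add: R_integrand_sin)
qed


text \<open>The line comes in from the first quadrant (r tending to minus infinity) and leaves
  through the third. It is deformed into the ray of eta traversed inwards, contributing -I, followed
  by the opposite ray traversed outwards, contributing exp (i pi s) I by the reflection
  rule.\<close>

lemma riemann_R_eq_ray_integral:
  fixes s \<eta> :: complex
  assumes s: "Re s \<le> - 1" and \<eta>: "Re \<eta> > 0" "Im \<eta> > 0"
    and int: "set_integrable lborel {0<..} (\<lambda>\<tau>::real. R_integrand s (\<eta> * of_real \<tau>))"
  shows "riemann_R s = (exp (\<i> * pi * s) - 1) * \<eta> * (LINT \<tau>:{0<..}|lborel. R_integrand s (\<eta> * of_real \<tau>))"
proof -
  define f where "f = R_integrand s"
  have hol: "f holomorphic_on cut_plane" unfolding f_def by (rule holomorphic_R_integrand)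
  note contf = holomorphic_on_imp_continuous_on[OF hol]
  obtain F where F: "\<And>x. x \<in> cut_plane \<Longrightarrow> (F has_field_derivative f x) (at x)"
    using holomorphic_starlike_primitive[OF contf starlike_cut_plane open_cut_plane finite.emptyI]
      holomorphic_on_imp_differentiable_at[OF hol open_cut_plane] by auto
  define I where "I = \<eta> * (LINT \<tau>:{0<..}|lborel. f (\<eta> * of_real \<tau>))"

  have riemann_R_lim: "(\<lambda>n. F (R_line (real n)) - F (R_line (- real n))) \<longlonglongrightarrow> riemann_R s"
  proof -
    have int1: "integrable lborel (\<lambda>r. f (R_line r) * swdir)"
      unfolding f_def using s by (intro integrable_R_line) auto
    have "riemann_R s = (LINT r|lborel. f (R_line r) * swdir)"
      unfolding riemann_R_def f_def R_line_def[symmetric]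
      using integral_lborel[OF int1] by (simp add: f_def)
    moreover have "(\<lambda>n. F (R_line (real n)) - F (R_line (- real n))) \<longlonglongrightarrow> (LINT r|lborel. f (R_line r) * swdir)"
    proof (rule LIMSEQ_FTC_UNIV[OF int1])
      fix r :: real
      have "((\<lambda>w. F (1 / 2 + w * swdir)) has_field_derivative f (R_line r) * swdir) (at (of_real r))"
        unfolding R_line_def
        by (rule DERIV_chain2[where f = F and g = "\<lambda>w. 1 / 2 + w * swdir"])
          (auto intro!: derivative_eq_intros F R_line_in_cut_plane[of r, unfolded R_line_def])
      then show "((\<lambda>r. F (R_line r)) has_vector_derivative f (R_line r) * swdir) (at r)"
        unfolding R_line_def by (rule has_vector_derivative_real_field)
    next
      show "continuous_on UNIV (\<lambda>r. f (R_line r) * swdir)"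
        by (intro continuous_intros continuous_on_compose2[OF contf continuous_on_R_line])
          (auto simp: R_line_in_cut_plane)
    qed
    ultimately show ?thesis by simp
  qed

  have ray_lim: "(\<lambda>n. F (e * \<eta> * of_real (real (Suc n))) - F (e * \<eta> * of_real (1 / real (Suc n)))) \<longlonglongrightarrow>
      (LINT \<tau>:{0<..}|lborel. f (e * \<eta> * of_real \<tau>) * (e * \<eta>))"
    if e: "e = 1 \<or> e = - 1" and int: "set_integrable lborel {0<..} (\<lambda>\<tau>::real. f (e * \<eta> * of_real \<tau>) * (e * \<eta>))"
    for e :: complex
  proof (rule LIMSEQ_FTC_Ioi[OF int])
    have in_S: "e * \<eta> * of_real \<tau> \<in> cut_plane" if "\<tau> > 0" for \<tau>
      using e \<eta> that by (auto simp: cut_plane_def)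
    fix \<tau> :: real assume \<tau>: "\<tau> > 0"
    have "((\<lambda>w. F (e * \<eta> * w)) has_field_derivative f (e * \<eta> * of_real \<tau>) * (e * \<eta>)) (at (of_real \<tau>))"
      by (rule DERIV_chain2[where f = F and g = "\<lambda>w. e * \<eta> * w"])
        (auto intro!: derivative_eq_intros F in_S \<tau>)
    then show "((\<lambda>\<tau>. F (e * \<eta> * of_real \<tau>)) has_vector_derivative f (e * \<eta> * of_real \<tau>) * (e * \<eta>)) (at \<tau>)"
      by (rule has_vector_derivative_real_field)
  next
    have "e * \<eta> * of_real \<tau> \<in> cut_plane" if "\<tau> > 0" for \<tau>
      using e \<eta> that by (auto simp: cut_plane_def)
    then show "continuous_on {0<..} (\<lambda>\<tau>::real. f (e * \<eta> * of_real \<tau>) * (e * \<eta>))"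
      by (intro continuous_intros continuous_on_compose2[OF contf]) auto
  qed
  have up: "(\<lambda>n. F (\<eta> * of_real (real (Suc n))) - F (\<eta> * of_real (1 / real (Suc n)))) \<longlonglongrightarrow> I"
  proof -
    have "set_integrable lborel {0<..} (\<lambda>\<tau>::real. f (1 * \<eta> * of_real \<tau>) * (1 * \<eta>))"
      using set_integrable_mult_left[OF int, of \<eta>] by (simp add: f_def)
    from ray_lim[OF _ this] show ?thesis by (simp add: I_def mult.commute)
  qed
  have f_neg: "f (- 1 * \<eta> * of_real \<tau>) * (- 1 * \<eta>) = exp (\<i> * pi * s) * \<eta> * f (\<eta> * of_real \<tau>)" if "\<tau> > 0" for \<tau> :: real
    using R_integrand_uminus[of "\<eta> * of_real \<tau>" s] \<eta> that by (simp add: f_def)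
  have down: "(\<lambda>n. F (- (\<eta> * of_real (real (Suc n)))) - F (- (\<eta> * of_real (1 / real (Suc n)))))
      \<longlonglongrightarrow> exp (\<i> * pi * s) * I"
  proof -
    have "set_integrable lborel {0<..} (\<lambda>\<tau>::real. f (- 1 * \<eta> * of_real \<tau>) * (- 1 * \<eta>)) \<longleftrightarrow>
      set_integrable lborel {0<..} (\<lambda>\<tau>::real. exp (\<i> * pi * s) * \<eta> * f (\<eta> * of_real \<tau>))"
      by (rule set_integrable_cong) (use f_neg in auto)
    then have 1: "set_integrable lborel {0<..} (\<lambda>\<tau>::real. f (- 1 * \<eta> * of_real \<tau>) * (- 1 * \<eta>))"
      using set_integrable_mult_right[OF int, of "exp (\<i> * pi * s) * \<eta>"] by (simp add: f_def)
    have "(LINT \<tau>:{0<..}|lborel. f (- 1 * \<eta> * of_real \<tau>) * (- 1 * \<eta>)) =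
        (LINT \<tau>:{0<..}|lborel. exp (\<i> * pi * s) * \<eta> * f (\<eta> * of_real \<tau>))"
      by (rule set_lebesgue_integral_cong) (use f_neg in auto)
    also have "\<dots> = exp (\<i> * pi * s) * I" by (simp add: I_def)
    finally show ?thesis using ray_lim[OF _ 1] by simp
  qed

  define K where "K = 1 + norm \<eta>"
  have K: "norm \<eta> \<le> K" "1 \<le> K" by (auto simp: K_def)
  \<comment> \<open>On the joining segments both coordinates, up to the common sign e, are at least
    k n, so their product is at least (k n)^2. On the line the smallest coordinate is n / sqrt 2 -
    1/2, and this is at least n / 4 once n \<ge> 2.\<close>
  define k where "k = min (1 / 4) (min (Re \<eta>) (Im \<eta>))"
  have k: "0 < k" "k \<le> 1 / 4" "k \<le> Re \<eta>" "k \<le> Im \<eta>" using \<eta> by (auto simp: k_def)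
  have far: "(\<lambda>n. F (R_line (- e * real n)) - F (of_real e * (\<eta> * of_real (real (Suc n))))) \<longlonglongrightarrow> 0"
    if e: "e = 1 \<or> e = - 1" for e :: real
  proof (rule primitive_diff_tendsto_0[of cut_plane F f, OF F])
    let ?B = "\<lambda>n. (K * real (Suc n)) powr (- Re s) * exp (pi * \<bar>Im s\<bar>) * exp (- 2 * pi * (k * real n)\<^sup>2)"
    have norms: "norm (R_line (- e * real n)) \<le> K * real (Suc n)"
      "norm (of_real e * (\<eta> * of_real (real (Suc n)))) \<le> K * real (Suc n)" for n
    proof -
      have "norm (R_line (- e * real n)) \<le> 1 * real (Suc n)"
        using norm_R_line_le[of "- e * real n"] e by auto
      also have "\<dots> \<le> K * real (Suc n)" using K by (intro mult_right_mono) auto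
      finally show "norm (R_line (- e * real n)) \<le> K * real (Suc n)" .
      have "norm (of_real e * (\<eta> * of_real (real (Suc n)))) = norm \<eta> * real (Suc n)"
        using e by (simp only: norm_mult norm_of_real) auto
      also have "\<dots> \<le> K * real (Suc n)" using K by (intro mult_right_mono) auto
      finally show "norm (of_real e * (\<eta> * of_real (real (Suc n)))) \<le> K * real (Suc n)" .
    qed
    have "\<forall>\<^sub>F n in sequentially. n \<ge> 2" by real_asymp
    moreover have "\<forall>\<^sub>F n in sequentially. k * real n \<ge> 1" using k by real_asymp
    ultimately show "\<forall>\<^sub>F n in sequentially. \<forall>x\<in>closed_segment (R_line (- e * real n)) (of_real e * (\<eta> * of_real (real (Suc n)))).
        x \<in> cut_plane \<and> norm (f x) \<le> ?B n"
    proof eventually_elim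
      case (elim n)
      define p where "p = R_line (- e * real n)"
      define q where "q = of_real e * (\<eta> * of_real (real (Suc n)))"
      have p: "k * real n \<le> e * Re p" "k * real n \<le> e * Im p"
      proof -
        have "real n / 2 \<le> real n / sqrt 2"
          using real_sqrt_le_mono[of 2 4] by (intro divide_left_mono) auto
        moreover have "k * real n \<le> 1 / 4 * real n" using k by (intro mult_right_mono) auto
        moreover have "2 \<le> real n" using elim by simp
        ultimately have "k * real n \<le> real n / sqrt 2 - 1 / 2" by linarith
        then show "k * real n \<le> e * Re p" "k * real n \<le> e * Im p"
          using e unfolding p_def Re_R_line Im_R_line by auto
      qed
      have q: "k * real n \<le> e * Re q" "k * real n \<le> e * Im q"
      proof -
        have "e * Re q = Re \<eta> * real (Suc n)" "e * Im q = Im \<eta> * real (Suc n)"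
          using e by (auto simp: q_def)
        moreover have "k * real n \<le> Re \<eta> * real (Suc n)" "k * real n \<le> Im \<eta> * real (Suc n)"
          using k by (intro mult_mono; simp)+
        ultimately show "k * real n \<le> e * Re q" "k * real n \<le> e * Im q" by simp_all
      qed
      show ?case
        unfolding p_def[symmetric] q_def[symmetric]
      proof
        fix x assume x: "x \<in> closed_segment p q"
        then obtain u where u: "0 \<le> u" "u \<le> 1" and x_eq: "x = (1 - u) *\<^sub>R p + u *\<^sub>R q"
          by (auto simp: closed_segment_def)
        have comb: "k * real n \<le> (1 - u) * a + u * b" if "k * real n \<le> a" "k * real n \<le> b" for a b
        proof -
          have "k * real n = (1 - u) * (k * real n) + u * (k * real n)" by (simp add: algebra_simps)
          also have "\<dots> \<le> (1 - u) * a + u * b" using u that by (intro add_mono mult_left_mono) auto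
          finally show ?thesis .
        qed
        have R: "k * real n \<le> e * Re x" using comb[OF p(1) q(1)] by (simp add: x_eq algebra_simps)
        have I: "k * real n \<le> e * Im x" using comb[OF p(2) q(2)] by (simp add: x_eq algebra_simps)
        have e2: "e * e = 1" using e by auto
        have "(k * real n)\<^sup>2 \<le> (e * Re x) * (e * Im x)"
          unfolding power2_eq_square using mult_mono[OF R I] R elim by linarith
        also have "\<dots> = (e * e) * (Re x * Im x)" by (simp only: mult_ac)
        finally have prod: "(k * real n)\<^sup>2 \<le> Re x * Im x" unfolding e2 by simp
        have Im1: "\<bar>Im x\<bar> \<ge> 1" using I elim e by auto
        have "norm x \<le> K * real (Suc n)"
          using closed_segment_norm_le[OF x] norms[of n] unfolding p_def q_def by blast
        then show "x \<in> cut_plane \<and> norm (f x) \<le> ?B n"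
          using norm_R_integrand_far_le[OF _ _ Im1 prod] s Im1 unfolding f_def cut_plane_def by auto
      qed
    qed
    show "(\<lambda>n. ?B n * norm (R_line (- e * real n) - of_real e * (\<eta> * of_real (real (Suc n))))) \<longlonglongrightarrow> 0"
    proof (rule Lim_null_comparison)
      have "K > 0" using K by simp
      then show "(\<lambda>n. ?B n * (2 * K * real (Suc n))) \<longlonglongrightarrow> 0"
        using k by real_asymp
      have "norm (R_line (- e * real n) - of_real e * (\<eta> * of_real (real (Suc n)))) \<le> 2 * K * real (Suc n)" for n
        using norm_triangle_ineq4[of "R_line (- e * real n)" "of_real e * (\<eta> * of_real (real (Suc n)))"] add_mono[OF norms[of n]]
        by linarith
      then show "\<forall>\<^sub>F n in sequentially. norm (?B n * norm (R_line (- e * real n) - of_real e * (\<eta> * of_real (real (Suc n)))))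
          \<le> ?B n * (2 * K * real (Suc n))"
        unfolding norm_mult by (intro always_eventually allI mult_mono) auto
    qed
  qed

  obtain B \<delta> where \<delta>: "\<delta> > 0" and B: "\<And>x. 0 < norm x \<Longrightarrow> norm x < \<delta> \<Longrightarrow> norm (f x) \<le> B"
    using R_integrand_bounded_near_0[OF s] unfolding f_def by metis
  \<comment> \<open>The straight connection of the two rays would run through 0, so it detours over
    a point of the gap (0,1). The factor 2 keeps that point off the pole at 1 when n = 0.\<close>
  have near: "(\<lambda>n. F (of_real e * (\<eta> * of_real (1 / real (Suc n)))) - F (of_real (1 / (2 * real (Suc n))))) \<longlonglongrightarrow> 0"
    if e: "e = 1 \<or> e = - 1" for e :: real
  proof (rule primitive_diff_tendsto_0[of cut_plane F f, OF F])
    have norms: "norm (of_real e * (\<eta> * of_real (1 / real (Suc n)))) \<le> K / real (Suc n)"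
      "norm (of_real (1 / (2 * real (Suc n))) :: complex) \<le> K / real (Suc n)" for n
    proof -
      define N where "N = real (Suc n)"
      have N: "N \<ge> 1" by (simp add: N_def)
      show "norm (of_real e * (\<eta> * of_real (1 / real (Suc n)))) \<le> K / real (Suc n)"
        unfolding norm_mult norm_of_real N_def[symmetric]
        using e K N by (auto simp: divide_right_mono)
      show "norm (of_real (1 / (2 * real (Suc n))) :: complex) \<le> K / real (Suc n)"
        unfolding norm_of_real N_def[symmetric] using K N by (simp add: field_simps)
    qed
    have "(\<lambda>n. K / real (Suc n)) \<longlonglongrightarrow> 0" by real_asymp
    from order_tendstoD(2)[OF this \<delta>]
    show "\<forall>\<^sub>F n in sequentially. \<forall>x\<in>closed_segment (of_real e * (\<eta> * of_real (1 / real (Suc n)))) (of_real (1 / (2 * real (Suc n)))).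
        x \<in> cut_plane \<and> norm (f x) \<le> B"
    proof eventually_elim
      case (elim n)
      show ?case
      proof
        fix x assume x: "x \<in> closed_segment (of_real e * (\<eta> * of_real (1 / real (Suc n)))) (of_real (1 / (2 * real (Suc n))))"
        define N where "N = real (Suc n)"
        have N: "N \<ge> 1" by (simp add: N_def)
        from x obtain u where u: "0 \<le> u" "u \<le> 1"
          and x_eq: "x = (1 - u) *\<^sub>R (of_real e * (\<eta> * of_real (1 / N))) + u *\<^sub>R of_real (1 / (2 * N))"
          by (auto simp: closed_segment_def N_def)
        have xS: "x \<in> cut_plane"
        proof (cases "u = 1")
          case True
          then show ?thesis using N by (simp add: x_eq cut_plane_def)
        next
          case False
          have "Im x = (1 - u) * (e * (Im \<eta> / N))" by (simp add: x_eq)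
          then have "Im x \<noteq> 0" using False e N \<eta> by auto
          then show ?thesis by (simp add: cut_plane_def)
        qed
        then have "x \<noteq> 0" by (auto simp: cut_plane_def)
        moreover have "norm x < \<delta>"
          using closed_segment_norm_le[OF x norms(1)[of n] norms(2)[of n]] elim by linarith
        ultimately show "x \<in> cut_plane \<and> norm (f x) \<le> B" using xS B[of x] by simp
      qed
    qed
    show "(\<lambda>n. B * norm (of_real e * (\<eta> * of_real (1 / real (Suc n))) - of_real (1 / (2 * real (Suc n))))) \<longlonglongrightarrow> 0"
    proof (rule tendsto_mult_right_zero, rule Lim_null_comparison)
      show "(\<lambda>n. 2 * K / real (Suc n)) \<longlonglongrightarrow> 0" by real_asymp
      show "\<forall>\<^sub>F n in sequentially. norm (norm (of_real e * (\<eta> * of_real (1 / real (Suc n))) - of_real (1 / (2 * real (Suc n)))))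
          \<le> 2 * K / real (Suc n)"
      proof (intro always_eventually allI)
        fix n
        show "norm (norm (of_real e * (\<eta> * of_real (1 / real (Suc n))) - of_real (1 / (2 * real (Suc n)))))
          \<le> 2 * K / real (Suc n)"
          using norm_triangle_ineq4[of "of_real e * (\<eta> * of_real (1 / real (Suc n)))" "of_real (1 / (2 * real (Suc n)))"]
            add_mono[OF norms[of n]] by simp
      qed
    qed
  qed

  \<comment> \<open>The values of F at the detour points cancel between the two signs, leaving only
    the ends of the line and of the rays.\<close>
  have "(\<lambda>n. (F (R_line (real n)) - F (R_line (- real n)))
      - ((F (- (\<eta> * of_real (real (Suc n)))) - F (- (\<eta> * of_real (1 / real (Suc n)))))
       - (F (\<eta> * of_real (real (Suc n))) - F (\<eta> * of_real (1 / real (Suc n)))))) \<longlonglongrightarrow> 0"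
    using tendsto_add[OF tendsto_diff[OF far[of "-1"] far[of 1]] tendsto_diff[OF near[of "-1"] near[of 1]]]
    by (simp add: algebra_simps)
  from LIMSEQ_unique[OF this tendsto_diff[OF riemann_R_lim tendsto_diff[OF down up]]]
  show ?thesis by (simp add: I_def f_def algebra_simps)
qed

section \<open>The factors of the main term\<close>

text \<open>With z = 1 - s, duplication treats Gamma (z/2) Gamma (z/2 + 1/2), and reflection treats
  Gamma (s/2) paired with the same second factor, since 1 - s/2 = z/2 + 1/2.\<close>

lemma chi_eq_Gamma:
  fixes s :: complex
  assumes "Re s < 1"
  shows "chi s = 2 * exp (- (1 - s) * complex_of_real (ln (2 * pi))) * sin (pi * s / 2) * Gamma (1 - s)"
proof -
  define z where "z = 1 - s"
  have nonpos: "w \<notin> \<int>\<^sub>\<le>\<^sub>0" if "Re w > 0" for w :: complex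
    using that by (auto elim!: nonpos_Ints_cases)
  have z: "Re z > 0" using assms by (simp add: z_def)
  have leg: "Gamma (z / 2) * Gamma (z / 2 + 1 / 2) = exp ((1 - z) * complex_of_real (ln 2)) * sqrt pi * Gamma z"
    using Gamma_legendre_duplication[of "z / 2"] nonpos[of "z / 2"] nonpos[of "z / 2 + 1 / 2"] z by simp
  have refl: "Gamma (s / 2) * Gamma (z / 2 + 1 / 2) = pi / sin (pi * s / 2)"
    using Gamma_reflection_complex[of "s / 2"] by (simp add: z_def field_simps)
  have Gamma_nz: "Gamma (z / 2 + 1 / 2) \<noteq> 0"
    using nonpos[of "z / 2 + 1 / 2"] z by (simp add: Gamma_eq_zero_iff)
  have inv: "1 / Gamma (s / 2) = Gamma (z / 2 + 1 / 2) * sin (pi * s / 2) / pi"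
  proof (cases "Gamma (s / 2) = 0")
    case True
    then show ?thesis using refl by simp
  next
    case False
    with refl Gamma_nz have "sin (pi * s / 2) \<noteq> 0" by auto
    with refl False show ?thesis by (simp add: eq_divide_eq divide_eq_eq mult_ac)
  qed
  have "chi s = pi powr (s - 1 / 2) * (Gamma (z / 2) * (1 / Gamma (s / 2)))"
    by (simp add: chi_def z_def)
  also have "\<dots> = pi powr (s - 1 / 2) * (Gamma (z / 2) * Gamma (z / 2 + 1 / 2)) * sin (pi * s / 2) / pi"
    unfolding inv by simp
  also have "\<dots> = (pi powr (s - 1 / 2) * exp ((1 - z) * complex_of_real (ln 2)) * sqrt pi / pi) * sin (pi * s / 2) * Gamma z"
    unfolding leg by simp
  also have "pi powr (s - 1 / 2) * exp ((1 - z) * complex_of_real (ln 2)) * sqrt pi / pi = 2 * exp (- z * complex_of_real (ln (2 * pi)))"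
  proof -
    have sqrtpi: "complex_of_real (sqrt pi) = exp (of_real (ln pi) / 2)"
    proof -
      have "sqrt pi = exp (ln pi / 2)" using exp_ln[of "sqrt pi"] by (simp add: ln_sqrt)
      then show ?thesis by (simp flip: exp_of_real)
    qed
    have pi_exp: "complex_of_real pi = exp (of_real (ln pi))" by (simp add: exp_of_real)
    have two_exp: "2 = exp (complex_of_real (ln 2))" by (simp only: exp_of_real) simp
    have "pi powr (s - 1 / 2) * exp ((1 - z) * complex_of_real (ln 2)) * sqrt pi / pi =
       exp ((s - 1 / 2) * of_real (ln pi) + (1 - z) * complex_of_real (ln 2) + of_real (ln pi) / 2 - of_real (ln pi))"
      by (simp only: exp_add exp_diff sqrtpi pi_exp[symmetric]) (simp add: powr_def Ln_of_real)
    also have "\<dots> = exp (complex_of_real (ln 2) + - z * complex_of_real (ln (2 * pi)))"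
      by (rule arg_cong[of _ _ exp]) (simp add: z_def ln_mult field_simps)
    also have "\<dots> = 2 * exp (- z * complex_of_real (ln (2 * pi)))" by (simp only: exp_add two_exp[symmetric])
    finally show ?thesis .
  qed
  finally show ?thesis by (simp add: z_def)
qed

text \<open>The number under the root has positive imaginary part, so one root lies in the open
  first quadrant, inside the prescribed window of arguments, and the other in the third, outside it.
  The window thus selects the principal root.\<close>

lemma eta_eq:
  fixes s :: complex
  assumes "Re s < 1"
  shows "eta s ^ 2 = \<i> * (1 - s) / (2 * pi)" and "Re (eta s) > 0" and "Im (eta s) > 0"
proof -
  define \<zeta> where "\<zeta> = (s - 1) / (2 * pi * \<i>)"
  have \<zeta>: "\<zeta> = \<i> * (1 - s) / (2 * pi)" by (simp add: \<zeta>_def field_simps)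
  define w where "w = csqrt \<zeta>"
  have w2: "w\<^sup>2 = \<zeta>" by (simp add: w_def)
  have "Im \<zeta> > 0" using assms unfolding \<zeta> by (simp add: Im_divide_of_real flip: of_real_mult)
  then have "2 * (Re w * Im w) > 0" unfolding w2[symmetric] by (simp add: power2_eq_square)
  moreover have "Re w \<ge> 0" using Re_csqrt[of \<zeta>] unfolding w_def by auto
  ultimately have w: "Re w > 0" "Im w > 0" by (auto simp: zero_less_mult_iff)
  have Arg_w: "- (pi / 4) < Arg w" "Arg w < 3 * pi / 4"
  proof -
    have "w \<noteq> 0" using w by auto
    then have "\<bar>Arg w\<bar> < pi / 2" using w Re_Ln_pos_lt[of w] by (simp add: Arg_eq_Im_Ln)
    moreover have "Arg w > 0" using w Arg_lt_pi[of w] by simp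
    ultimately show "- (pi / 4) < Arg w" "Arg w < 3 * pi / 4" using pi_gt_zero by linarith+
  qed
  have "eta s = w"
    unfolding eta_def \<zeta>_def[symmetric]
  proof (rule the_equality)
    fix v assume v: "v\<^sup>2 = \<zeta> \<and> - (pi / 4) < Arg v \<and> Arg v < 3 * pi / 4"
    then have "v = w \<or> v = - w" using w2 by (metis power2_eq_iff)
    then show "v = w"
    proof
      assume v': "v = - w"
      then have "v \<noteq> 0" "\<not> Re v \<ge> 0" "Im v < 0" using w by auto
      then have "\<not> \<bar>Arg v\<bar> \<le> pi / 2" "Arg v < 0"
        using Re_Ln_pos_le[of v] Arg_neg_iff[of v] by (simp_all add: Arg_eq_Im_Ln)
      then have "Arg v < - (pi / 4)" using pi_gt_zero by linarith
      then show ?thesis using v by simp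
    qed
  qed (use w2 Arg_w in auto)
  then show "eta s ^ 2 = \<i> * (1 - s) / (2 * pi)" "Re (eta s) > 0" "Im (eta s) > 0"
    using w w2 \<zeta> by auto
qed

text \<open>In the variable z = 1 - s the region is the sector |arg z| \<le> pi/2 - 2 \<alpha>, and
  the cosine of that angle is sin (2 \<alpha>).\<close>

lemma G_region_Re_ge:
  assumes "0 < \<alpha>" "\<alpha> < pi / 4" "s \<in> G_region \<alpha>"
  shows "sin (2 * \<alpha>) * norm (1 - s) \<le> Re (1 - s)"
proof -
  have pos: "sin (2 * \<alpha>) > 0" "cos (2 * \<alpha>) > 0"
    using assms by (auto intro: sin_gt_zero cos_gt_zero)
  define x y where "x = Re (1 - s)" and "y = Im (1 - s)"
  have "\<bar>y\<bar> * tan (2 * \<alpha>) \<le> x" using assms(3) by (simp add: G_region_def x_def y_def)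
  then have le: "\<bar>y\<bar> * sin (2 * \<alpha>) \<le> x * cos (2 * \<alpha>)"
    using pos by (simp add: tan_def field_simps)
  moreover have "0 \<le> \<bar>y\<bar> * sin (2 * \<alpha>)" using pos by simp
  ultimately have "0 \<le> x * cos (2 * \<alpha>)" by linarith
  then have x0: "x \<ge> 0" using pos by (simp add: zero_le_mult_iff)
  have "(\<bar>y\<bar> * sin (2 * \<alpha>))\<^sup>2 \<le> (x * cos (2 * \<alpha>))\<^sup>2"
    using le pos by (intro power_mono) auto
  then have "y\<^sup>2 * (sin (2 * \<alpha>))\<^sup>2 \<le> x\<^sup>2 * (1 - (sin (2 * \<alpha>))\<^sup>2)"
    by (simp add: power_mult_distrib cos_squared_eq)
  then have "(sin (2 * \<alpha>) * norm (1 - s))\<^sup>2 \<le> x\<^sup>2"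
    by (simp add: power_mult_distrib cmod_power2 x_def y_def algebra_simps)
  then show ?thesis using x0 unfolding x_def by (rule power2_le_imp_le)
qed

section \<open>Both sides as a common factor times a saddle integral\<close>

lemma R_integrand_ray:
  fixes s \<eta> z :: complex and \<tau> :: real
  assumes "\<eta> \<noteq> 0" "\<tau> > 0" and z: "z = 1 - s" and \<eta>2: "\<eta>\<^sup>2 = \<i> * z / (2 * pi)"
  shows "R_integrand s (\<eta> * \<tau>) = - exp (z * Ln \<eta> - z / 2 + pi * \<i> * \<eta>) / \<eta> *
    (exp (z * saddle_phase \<tau> + pi * \<i> * \<eta> * (of_real \<tau> - 1)) * (1 / (1 - exp (2 * pi * \<i> * \<eta> * \<tau>))) / \<tau>)"
proof -
  define X where "X = exp (pi * \<i> * \<eta> * \<tau>)"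
  have X0: "X \<noteq> 0" by (simp add: X_def)
  have den: "exp (pi * \<i> * (\<eta> * \<tau>)) - exp (- (pi * \<i> * (\<eta> * \<tau>))) = - (1 - X\<^sup>2) / X"
  proof -
    have "exp (pi * \<i> * (\<eta> * \<tau>)) = X" "exp (- (pi * \<i> * (\<eta> * \<tau>))) = 1 / X"
      by (simp_all add: X_def exp_minus field_simps)
    then show ?thesis using X0 by (simp add: field_simps power2_eq_square)
  qed
  have X2: "exp (2 * pi * \<i> * \<eta> * \<tau>) = X\<^sup>2"
    unfolding X_def exp_double[symmetric] by (simp add: mult_ac)
  have p: "(\<eta> * \<tau>) powr (- s) = exp (z * Ln \<eta> + z * ln \<tau>) / (\<eta> * \<tau>)"
  proof -
    have "(\<eta> * \<tau>) powr (- s) = exp ((z - 1) * (Ln \<eta> + ln \<tau>))"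
      using assms Ln_times_of_real[of \<tau> \<eta>] by (simp add: powr_def add.commute[of "Ln \<eta>"] Ln_of_real mult.commute[of \<eta>])
    also have "(z - 1) * (Ln \<eta> + ln \<tau>) = (z * Ln \<eta> + z * ln \<tau>) - (Ln \<eta> + ln \<tau>)"
      by (simp add: algebra_simps)
    also have "exp \<dots> = exp (z * Ln \<eta> + z * ln \<tau>) / (\<eta> * \<tau>)"
      using assms by (simp only: exp_diff[of "_ + _" "_ + _"] exp_add[of "Ln \<eta>"] exp_of_real) simp
    finally show ?thesis .
  qed
  have q: "pi * \<i> * (\<eta> * \<tau>)\<^sup>2 = - z * of_real (\<tau>\<^sup>2) / 2"
    unfolding power_mult_distrib \<eta>2 by (simp add: field_simps)
  have e: "exp (z * Ln \<eta> - z / 2 + pi * \<i> * \<eta>) * exp (z * saddle_phase \<tau> + pi * \<i> * \<eta> * (of_real \<tau> - 1)) =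
      exp (z * Ln \<eta> + z * ln \<tau>) * exp (- z * of_real (\<tau>\<^sup>2) / 2) * X"
    unfolding X_def exp_add[symmetric]
    by (rule arg_cong[of _ _ exp]) (simp add: saddle_phase_def field_simps)
  have "R_integrand s (\<eta> * \<tau>) =
      - (exp (z * Ln \<eta> + z * ln \<tau>) * exp (- z * of_real (\<tau>\<^sup>2) / 2) * X) / (\<eta> * \<tau> * (1 - X\<^sup>2))"
    unfolding R_integrand_def p q den using X0 by (simp only: minus_divide_left[symmetric] divide_minus_right) (simp add: field_simps)
  then show ?thesis unfolding e[symmetric] X2 by simp
qed

text \<open>With t = - Re w the claim reduces to 1 / (e^t - 1) \<le> 1 / t. On the ray, t is
  proportional to \<tau>, giving the amplitude error allowed in the saddle estimate.\<close>

lemma norm_inverse_one_minus_exp_le: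
  fixes w :: complex
  assumes "Re w < 0"
  shows "norm (1 / (1 - exp w) - 1) \<le> 1 / (- Re w)"
proof -
  define r where "r = exp (Re w)"
  have r: "0 < r" "r < 1" using assms by (auto simp: r_def)
  have "norm (exp w) = r" by (simp add: r_def)
  then have "1 - r \<le> norm (1 - exp w)" using norm_triangle_ineq2[of 1 "exp w"] by simp
  moreover have "exp w \<noteq> 1" using \<open>norm (exp w) = r\<close> r by (metis less_irrefl norm_one)
  moreover from this have "1 / (1 - exp w) - 1 = exp w / (1 - exp w)" by (simp add: field_simps)
  ultimately have "norm (1 / (1 - exp w) - 1) \<le> r / (1 - r)"
    using r \<open>norm (exp w) = r\<close> by (auto simp only: norm_divide intro!: frac_le)
  also have "r / (1 - r) \<le> 1 / (- Re w)"
  proof -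
    have "1 - Re w \<le> exp (- Re w)" using exp_ge_add_one_self[of "- Re w"] by simp
    then have "(1 - Re w) * r \<le> exp (- Re w) * r" using r by (intro mult_right_mono) auto
    then have "(1 - Re w) * r \<le> 1" by (simp add: r_def flip: exp_add)
    then show ?thesis using r assms by (simp add: field_simps)
  qed
  finally show ?thesis .
qed

text \<open>The point is that Q is the same in both equations: it carries the huge exponential
  factor and the oscillating 1 - exp (i pi s), and it drops out of the relative error. At negative
  even integers Q = 0 and both sides vanish together.\<close>

lemma riemann_R_and_R_main_saddle_form:
  fixes s z \<eta> :: complex and h1 h2 :: "real \<Rightarrow> complex"
  assumes s: "Re s \<le> - 1" and z_def: "z = 1 - s" and \<eta>_def: "\<eta> = eta s"
    and h1: "h1 = (\<lambda>\<tau>::real. exp (z * saddle_phase \<tau> + pi * \<i> * \<eta> * (of_real \<tau> - 1))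
       * (1 / (1 - exp (2 * pi * \<i> * \<eta> * \<tau>))) / \<tau>)"
    and h2: "h2 = (\<lambda>\<tau>::real. exp (2 * z * saddle_phase \<tau>) / \<tau>)"
    and int1: "set_integrable lborel {0<..} h1"
    and int2: "set_integrable lborel {0<..} h2"
  obtains Q where "riemann_R s = Q * (LINT \<tau>:{0<..}|lborel. h1 \<tau>)"
    "R_main s = Q * exp (- (pi * \<i> / 8)) * sqrt 2 * (LINT \<tau>:{0<..}|lborel. h2 \<tau>)"
proof
  define E where "E = exp (z * Ln \<eta> - z / 2 + pi * \<i> * \<eta>)"
  define Q where "Q = - (exp (\<i> * pi * s) - 1) * E"
  have "Re s < 1" using s by simp
  note eta = eta_eq[OF this, folded \<eta>_def z_def]
  have \<eta>0: "\<eta> \<noteq> 0" using eta by auto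
  have Rez: "Re z \<ge> 1" using s by (simp add: z_def)
  have ray: "R_integrand s (\<eta> * of_real \<tau>) = - E / \<eta> * h1 \<tau>" if "\<tau> > 0" for \<tau> :: real
    using R_integrand_ray[OF \<eta>0 that z_def eta(1)] by (simp only: E_def h1)
  have "set_integrable lborel {0<..} (\<lambda>\<tau>::real. R_integrand s (\<eta> * of_real \<tau>)) \<longleftrightarrow>
      set_integrable lborel {0<..} (\<lambda>\<tau>. - E / \<eta> * h1 \<tau>)"
    by (rule set_integrable_cong) (use ray in auto)
  then have int: "set_integrable lborel {0<..} (\<lambda>\<tau>::real. R_integrand s (\<eta> * of_real \<tau>))"
    using set_integrable_mult_right[of "- E / \<eta>", OF int1] by simp
  have "(LINT \<tau>:{0<..}|lborel. R_integrand s (\<eta> * of_real \<tau>)) = (LINT \<tau>:{0<..}|lborel. - E / \<eta> * h1 \<tau>)"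
    by (rule set_lebesgue_integral_cong) (use ray in auto)
  also have "\<dots> = - E / \<eta> * (LINT \<tau>:{0<..}|lborel. h1 \<tau>)" by (rule set_integral_mult_right)
  finally show "riemann_R s = Q * (LINT \<tau>:{0<..}|lborel. h1 \<tau>)"
    using riemann_R_eq_ray_integral[OF s eta(2,3) int] \<eta>0 by (simp add: Q_def algebra_simps)

  define J where "J = (LINT \<tau>:{0<..}|lborel. h2 \<tau>)"
  have Gamma: "Gamma z = 2 * exp (z * Ln z - z) * J"
    unfolding J_def h2 using Rez int2[unfolded h2] by (rule Gamma_eq_saddle_integral)
  \<comment> \<open>From z = - 2 pi i \<eta>^2. No multiple of 2 pi i enters: the argument of \<eta>
    lies in (0, pi/2), so the imaginary part on the right lies in (-pi/2, pi/2).\<close>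
  have Lnz: "Ln z = of_real (ln (2 * pi)) - \<i> * pi / 2 + 2 * Ln \<eta>"
  proof -
    have "exp (of_real (ln (2 * pi)) - \<i> * pi / 2 + 2 * Ln \<eta>) = z"
    proof -
      have "exp (of_real (ln (2 * pi)) - \<i> * pi / 2 + 2 * Ln \<eta>) =
          exp (complex_of_real (ln (2 * pi))) * exp (- (\<i> * pi / 2)) * exp (Ln \<eta>) ^ 2"
        unfolding exp_double[symmetric] exp_add[symmetric] by simp
      also have "exp (complex_of_real (ln (2 * pi))) = 2 * pi" by (simp only: exp_of_real) simp
      also have "exp (- (\<i> * pi / 2)) = - \<i>"
        using cis_minus_pi_half by (simp add: cis_conv_exp)
      also have "exp (Ln \<eta>) ^ 2 = \<i> * z / (2 * pi)" using \<eta>0 eta(1) by simp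
      finally show ?thesis by (simp add: field_simps)
    qed
    moreover have "- pi < Im (of_real (ln (2 * pi)) - \<i> * pi / 2 + 2 * Ln \<eta>)"
      "Im (of_real (ln (2 * pi)) - \<i> * pi / 2 + 2 * Ln \<eta>) \<le> pi"
      using Im_Ln_pos_lt[of \<eta>] Re_Ln_pos_lt[of \<eta>] \<eta>0 eta(2,3) pi_gt_zero by auto
    ultimately show ?thesis using Ln_unique by metis
  qed
  \<comment> \<open>The sine in \<chi>, combined with the phase left over from \<open>Ln z\<close>,
    is exactly the factor that the two rays produce.\<close>
  have osc: "2 * sin (pi * s / 2) * exp (- (\<i> * pi * z / 2)) = - (exp (\<i> * pi * s) - 1)"
  proof -
    define u where "u = exp (\<i> * (pi * s / 2))"
    have u0: "u \<noteq> 0" by (simp add: u_def)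
    have "exp (- (\<i> * pi * z / 2)) = exp (- (\<i> * pi / 2)) * u"
      unfolding u_def exp_add[symmetric] by (rule arg_cong[of _ _ exp]) (simp add: z_def field_simps)
    also have "exp (- (\<i> * pi / 2)) = - \<i>"
      using cis_minus_pi_half by (simp add: cis_conv_exp)
    finally have 1: "exp (- (\<i> * pi * z / 2)) = - \<i> * u" .
    have 2: "exp (\<i> * pi * s) = u\<^sup>2"
      unfolding u_def exp_double[symmetric] by (simp add: mult_ac)
    have "exp (- (\<i> * (pi * s / 2))) = 1 / u"
      unfolding u_def exp_minus by (rule inverse_eq_divide)
    then have 3: "sin (pi * s / 2) = (u - 1 / u) / (2 * \<i>)"
      by (simp only: sin_exp_eq u_def)
    show ?thesis unfolding 1 2 3 using u0 by (simp add: field_simps power2_eq_square)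
  qed
  have "R_main s = exp (- (pi * \<i> / 8)) / sqrt 2 *
      (2 * exp (- z * complex_of_real (ln (2 * pi))) * sin (pi * s / 2) * (2 * exp (z * Ln z - z) * J)) *
      exp (- z * Ln \<eta>) * exp (pi * \<i> * \<eta> + z / 2)"
  proof -
    have "pi * \<i> * (\<eta> - \<eta>\<^sup>2) = pi * \<i> * \<eta> + z / 2"
      unfolding eta(1) by (simp add: field_simps)
    moreover have "\<eta> powr (s - 1) = exp (- z * Ln \<eta>)" using \<eta>0 by (simp add: powr_def z_def)
    ultimately show ?thesis
      using chi_eq_Gamma[OF \<open>Re s < 1\<close>] Gamma by (simp only: R_main_def \<eta>_def z_def)
  qed
  also have "\<dots> = exp (- (pi * \<i> / 8)) / sqrt 2 * 2 * J * (2 * sin (pi * s / 2)) *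
      (exp (- z * complex_of_real (ln (2 * pi))) * exp (z * Ln z - z) * exp (- z * Ln \<eta>) * exp (pi * \<i> * \<eta> + z / 2))"
    by simp
  also have "exp (- z * complex_of_real (ln (2 * pi))) * exp (z * Ln z - z) * exp (- z * Ln \<eta>) * exp (pi * \<i> * \<eta> + z / 2)
     = exp (- (\<i> * pi * z / 2)) * E"
    unfolding Lnz E_def exp_add[symmetric]
    by (rule arg_cong[of _ _ exp]) (simp add: field_simps)
  also have "exp (- (pi * \<i> / 8)) / sqrt 2 * 2 * J * (2 * sin (pi * s / 2)) * (exp (- (\<i> * pi * z / 2)) * E)
      = exp (- (pi * \<i> / 8)) * (2 / sqrt 2) * J * (2 * sin (pi * s / 2) * exp (- (\<i> * pi * z / 2))) * E"
    by simp
  also have "\<dots> = Q * exp (- (pi * \<i> / 8)) * sqrt 2 * J"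
  proof -
    have "2 / complex_of_real (sqrt 2) = sqrt 2"
      using real_div_sqrt[of 2] by (metis of_real_divide of_real_numeral zero_le_numeral)
    then show ?thesis unfolding osc Q_def by simp
  qed
  finally show "R_main s = Q * exp (- (pi * \<i> / 8)) * sqrt 2 * (LINT \<tau>:{0<..}|lborel. h2 \<tau>)"
    unfolding J_def .
qed

section \<open>The relative error, uniformly in the sector\<close>

theorem mainTheorem7:
  fixes \<alpha> :: real
  assumes "0 < \<alpha>" and "\<alpha> < pi / 4"
  shows "\<exists>C R0. \<forall>s \<in> G_region \<alpha>. norm s \<ge> R0 \<longrightarrow>
           norm (riemann_R s - R_main s) \<le> C * norm (R_main s) / norm (eta s)"
proof -
  define c where "c = sin (2 * \<alpha>)"
  have c: "c > 0" unfolding c_def using assms by (intro sin_gt_zero) auto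
  obtain C1 where C1: "\<And>(\<kappa> :: complex) (l :: complex) (m :: real \<Rightarrow> complex).
      c * norm \<kappa> \<le> Re \<kappa> \<Longrightarrow> 4 \<le> c * norm \<kappa> \<Longrightarrow> norm l \<le> pi * sqrt (norm \<kappa>) \<Longrightarrow>
      continuous_on {0<..} m \<Longrightarrow> (\<And>\<tau>. \<tau> > 0 \<Longrightarrow> norm (m \<tau> - 1) \<le> (1 / c) / (sqrt (norm \<kappa>) * \<tau>)) \<Longrightarrow>
      set_integrable lborel {0<..} (\<lambda>\<tau>. exp (\<kappa> * saddle_phase \<tau> + l * (of_real \<tau> - 1)) * m \<tau> / \<tau>) \<and>
      norm (sqrt (norm \<kappa>) * (LINT \<tau>:{0<..}|lborel. exp (\<kappa> * saddle_phase \<tau> + l * (of_real \<tau> - 1)) * m \<tau> / \<tau>)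
        - sqrt pi / csqrt (\<kappa> / norm \<kappa>) * exp (l\<^sup>2 / (4 * \<kappa>))) \<le> C1 / sqrt (norm \<kappa>)"
    using saddle_ray_integral[of c "1 / c" pi] c by auto
  define C where "C = \<bar>C1\<bar>"
  \<comment> \<open>In the threshold, 1 pays for passing from s to 1 - s, 4 / c makes the saddle
    estimate applicable, and \<open>4 * C\<^sup>2\<close> forces C / \<rho> \<le> 1/2.\<close>
  have main: "norm (riemann_R s - R_main s) \<le> (4 * C) * norm (R_main s) / norm (eta s)"
    if sG: "s \<in> G_region \<alpha>" and s_large: "norm s \<ge> 1 + 4 / c + 4 * C\<^sup>2" for s
  proof -
    define z where "z = 1 - s"
    define \<rho> where "\<rho> = sqrt (norm z)"
    define \<eta> where "\<eta> = eta s"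
    have Rez: "c * norm z \<le> Re z"
      using G_region_Re_ge[OF assms sG] by (simp add: c_def z_def)
    have z_large: "norm z \<ge> 4 / c + 4 * C\<^sup>2"
      using s_large norm_triangle_ineq2[of s 1] by (simp add: z_def norm_minus_commute)
    have "norm z \<ge> 4 / c" using z_large zero_le_power2[of C] by linarith
    then have cz: "4 \<le> c * norm z" using c by (simp add: field_simps)
    have z0: "z \<noteq> 0" using cz by auto
    have s1: "Re s \<le> - 1" "Re s < 1" using Rez cz by (auto simp: z_def)
    note eta = eta_eq[OF s1(2), folded \<eta>_def z_def]
    have \<rho>0: "\<rho> > 0" using z0 by (simp add: \<rho>_def)
    have "norm \<eta> ^ 2 = norm z / (2 * pi)"
      unfolding norm_power[symmetric] eta(1) by (simp add: norm_divide norm_mult)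
    then have \<rho>\<eta>: "\<rho>\<^sup>2 = 2 * pi * (norm \<eta>)\<^sup>2" by (simp add: \<rho>_def)
    have "(norm \<eta>)\<^sup>2 \<le> \<rho>\<^sup>2"
      unfolding \<rho>\<eta> using pi_gt3 mult_right_mono[of 1 "2 * pi" "(norm \<eta>)\<^sup>2"] by simp
    then have \<eta>_le: "norm \<eta> \<le> \<rho>" by (rule power2_le_imp_le) (use \<rho>0 in simp)
    have "\<rho>\<^sup>2 \<le> (3 * norm \<eta>)\<^sup>2"
      unfolding \<rho>\<eta> using pi_less_4 mult_right_mono[of "2 * pi" 9 "(norm \<eta>)\<^sup>2"] by (simp add: power_mult_distrib)
    then have \<rho>_le: "\<rho> \<le> 3 * norm \<eta>" by (rule power2_le_imp_le) simp
    have \<eta>0: "norm \<eta> > 0" using eta by auto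
    \<comment> \<open>The sector condition on z keeps the ray of \<eta> at a fixed angle from the
      real axis and its poles, since Re z / (2 pi) = 2 Re \<eta> Im \<eta>. This makes the amplitude
      bound uniform.\<close>
    have Im\<eta>: "c * norm \<eta> \<le> 2 * Im \<eta>"
    proof -
      have "c * (norm \<eta>)\<^sup>2 = c * norm z / (2 * pi)"
        using \<rho>\<eta> by (simp add: \<rho>_def field_simps)
      also have "\<dots> \<le> Re z / (2 * pi)" using Rez by (intro divide_right_mono) auto
      also have "\<dots> = Im (\<eta>\<^sup>2)" unfolding eta(1) by (simp add: Im_divide_of_real flip: of_real_mult)
      also have "\<dots> = Re \<eta> * (2 * Im \<eta>)" by (simp add: power2_eq_square)
      also have "\<dots> \<le> norm \<eta> * (2 * Im \<eta>)"
        using eta complex_Re_le_cmod[of \<eta>] by (intro mult_right_mono) auto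
      finally have "norm \<eta> * (c * norm \<eta>) \<le> norm \<eta> * (2 * Im \<eta>)" by (simp add: power2_eq_square mult_ac)
      then show ?thesis using \<eta>0 by simp
    qed
    define h1 where "h1 = (\<lambda>\<tau>::real. exp (z * saddle_phase \<tau> + pi * \<i> * \<eta> * (of_real \<tau> - 1))
       * (1 / (1 - exp (2 * pi * \<i> * \<eta> * \<tau>))) / \<tau>)"
    define h2 where "h2 = (\<lambda>\<tau>::real. exp (2 * z * saddle_phase \<tau>) / \<tau>)"
    define J1 where "J1 = (LINT \<tau>:{0<..}|lborel. h1 \<tau>)"
    define J2 where "J2 = (LINT \<tau>:{0<..}|lborel. h2 \<tau>)"
    define g where "g = sqrt pi / csqrt (z / norm z)"
    have Re_neg: "Re (2 * pi * \<i> * \<eta> * of_real \<tau>) = - (2 * pi * Im \<eta> * \<tau>)" for \<tau> :: real by simp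
    have saddle1: "set_integrable lborel {0<..} h1 \<and>
        norm (\<rho> * J1 - g * exp ((pi * \<i> * \<eta>)\<^sup>2 / (4 * z))) \<le> C1 / \<rho>"
      unfolding h1_def J1_def g_def \<rho>_def
    proof (rule C1[OF Rez cz])
      show "norm (pi * \<i> * \<eta>) \<le> pi * sqrt (norm z)"
        using \<eta>_le by (simp add: norm_mult \<rho>_def)
      have "exp (2 * pi * \<i> * \<eta> * of_real \<tau>) \<noteq> 1" if "\<tau> > 0" for \<tau> :: real
      proof
        assume "exp (2 * pi * \<i> * \<eta> * of_real \<tau>) = 1"
        then have "exp (Re (2 * pi * \<i> * \<eta> * of_real \<tau>)) = 1" by (metis norm_exp_eq_Re norm_one)
        then show False using that eta unfolding Re_neg by auto
      qed
      then show "continuous_on {0<..} (\<lambda>\<tau>::real. 1 / (1 - exp (2 * pi * \<i> * \<eta> * \<tau>)))"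
        by (intro continuous_intros) auto
      fix \<tau> :: real assume \<tau>: "\<tau> > 0"
      have "norm (1 / (1 - exp (2 * pi * \<i> * \<eta> * \<tau>)) - 1) \<le> 1 / (2 * pi * Im \<eta> * \<tau>)"
        using norm_inverse_one_minus_exp_le[of "2 * pi * \<i> * \<eta> * \<tau>"] \<tau> eta unfolding Re_neg by simp
      also have "\<dots> \<le> 1 / (c * \<rho> * \<tau>)"
      proof (rule divide_left_mono)
        have "c * \<rho> \<le> c * (3 * norm \<eta>)" using \<rho>_le c by (intro mult_left_mono) auto
        also have "\<dots> \<le> 3 * (2 * Im \<eta>)" using Im\<eta> by simp
        also have "\<dots> \<le> pi * (2 * Im \<eta>)" using pi_gt3 eta by (intro mult_right_mono) auto
        finally show "c * \<rho> * \<tau> \<le> 2 * pi * Im \<eta> * \<tau>" using \<tau> by (simp add: mult_right_mono mult_ac)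
      qed (use c \<rho>0 \<tau> eta in auto)
      finally show "norm (1 / (1 - exp (2 * pi * \<i> * \<eta> * \<tau>)) - 1) \<le> 1 / c / (sqrt (norm z) * \<tau>)"
        by (simp add: \<rho>_def mult.assoc)
    qed
    \<comment> \<open>The Gamma integral is the case \<kappa> = 2 z with no linear term and
      amplitude 1. Doubling z does not change its direction, so the same constant g appears as in
      the first integral.\<close>
    have saddle2: "set_integrable lborel {0<..} h2 \<and> norm (sqrt 2 * \<rho> * J2 - g) \<le> C1 / (sqrt 2 * \<rho>)"
    proof -
      have "2 * z / norm (2 * z) = z / norm z" by (simp add: norm_mult)
      moreover have "sqrt (norm (2 * z)) = sqrt 2 * \<rho>" by (simp add: norm_mult real_sqrt_mult \<rho>_def)
      moreover have "c * norm (2 * z) \<le> Re (2 * z)" "4 \<le> c * norm (2 * z)"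
        using Rez cz by (auto simp: norm_mult)
      ultimately show ?thesis
        using C1[of "2 * z" 0 "\<lambda>_. 1"] c \<rho>0
        unfolding h2_def J2_def g_def by simp
    qed
    have Gauss_const: "(pi * \<i> * \<eta>)\<^sup>2 / (4 * z) = - (pi * \<i> / 8)"
      unfolding power_mult_distrib eta(1) using z0 by (simp add: field_simps power2_eq_square)
    obtain Q where Q: "riemann_R s = Q * J1" "R_main s = Q * exp (- (pi * \<i> / 8)) * sqrt 2 * J2"
      using riemann_R_and_R_main_saddle_form[OF s1(1) z_def \<eta>_def h1_def h2_def] saddle1 saddle2
      unfolding J1_def J2_def by blast
    define A where "A = \<rho> * J1"
    define A' where "A' = sqrt 2 * \<rho> * J2"
    define k where "k = exp (- (pi * \<i> / 8))"
    have k: "norm k = 1" by (simp add: k_def norm_exp_eq_Re)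
    have C1_le: "C1 / \<rho> \<le> C / \<rho>" "C1 / (sqrt 2 * \<rho>) \<le> C / \<rho>"
      using \<rho>0 by (auto simp: C_def intro!: frac_le)
    have A: "norm (A - g * k) \<le> C / \<rho>"
      using saddle1 C1_le unfolding Gauss_const A_def k_def by linarith
    have A': "norm (A' - g) \<le> C / \<rho>"
      using saddle2 C1_le unfolding A'_def by linarith
    have ng: "norm g \<ge> 1"
    proof -
      have "norm (csqrt (z / norm z)) = 1" using z0 by (simp add: norm_divide)
      then show ?thesis using pi_gt3 by (simp add: g_def norm_divide)
    qed
    have "C / \<rho> \<le> 1 / 2"
    proof -
      have "4 * C\<^sup>2 \<le> norm z" using z_large c divide_pos_pos[of 4 c] by linarith
      then have "(2 * C)\<^sup>2 \<le> \<rho>\<^sup>2" by (simp add: \<rho>_def power_mult_distrib)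
      then have "2 * C \<le> \<rho>" by (rule power2_le_imp_le) (use \<rho>0 in simp)
      then show ?thesis using \<rho>0 by (simp add: field_simps)
    qed
    then have A'_ge: "norm A' \<ge> 1 / 2"
    proof -
      have "norm g - norm (A' - g) \<le> norm A'"
        using norm_triangle_ineq2[of g "g - A'"] by (simp add: norm_minus_commute)
      then show ?thesis using A' ng \<open>C / \<rho> \<le> 1 / 2\<close> by linarith
    qed
    have diff: "norm (A - k * A') \<le> 2 * C / \<rho>"
    proof -
      have "A - k * A' = (A - g * k) - k * (A' - g)" by (simp add: algebra_simps)
      also have "norm \<dots> \<le> norm (A - g * k) + norm (k * (A' - g))" by (rule norm_triangle_ineq4)
      also have "\<dots> \<le> C / \<rho> + C / \<rho>" using A A' by (intro add_mono) (auto simp: norm_mult k)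
      finally show ?thesis by simp
    qed
    have "riemann_R s - R_main s = Q / \<rho> * (A - k * A')"
      unfolding Q A_def A'_def k_def using \<rho>0 by (simp add: field_simps)
    then have "norm (riemann_R s - R_main s) = norm Q / \<rho> * norm (A - k * A')"
      using \<rho>0 by (simp add: norm_mult norm_divide)
    \<comment> \<open>The lower bound 1/2 for the norm of A' inserts the factor 2 |A'| \<ge> 1 and
      so brings in the main term without dividing by it. The constant is 4 C: a factor 2 from this
      insertion and 2 C from the two saddle errors.\<close>
    also have "\<dots> \<le> norm Q / \<rho> * (2 * C / \<rho> * (2 * norm A'))"
    proof (rule mult_left_mono)
      have "2 * C / \<rho> * 1 \<le> 2 * C / \<rho> * (2 * norm A')"
        using A'_ge \<rho>0 by (intro mult_left_mono) (auto simp: C_def)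
      then show "norm (A - k * A') \<le> 2 * C / \<rho> * (2 * norm A')" using diff by linarith
    qed (use \<rho>0 in auto)
    also have "\<dots> = 4 * C * (norm Q / \<rho> * norm A') / \<rho>" by simp
    also have "norm Q / \<rho> * norm A' = norm (R_main s)"
      unfolding Q A'_def k_def[symmetric] using \<rho>0 by (simp add: norm_mult k)
    also have "4 * C * norm (R_main s) / \<rho> \<le> 4 * C * norm (R_main s) / norm (eta s)"
      using \<eta>_le \<eta>0 unfolding \<eta>_def by (intro divide_left_mono) (auto simp: C_def \<eta>_def[symmetric] \<rho>0)
    finally show ?thesis .
  qed
  then show ?thesis by blast
qed

end
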